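(* Let $a$ be a fixed non-negative integer. Then $\mathbb{E}[\mathbf{Y}_n^a]\to\mathbb{E}[\mathbf{Y}^a]$ as $n\to\infty$. In particular, if $\pi\in\mathfrak{S}_n$ is chosen uniformly, then \[ \mathbb{E}[d(\pi)]\to 1+\sum_{d=0}^{\infty}e^{-d^2-d}\quad(\approx 2.13782) \] as $n\to\infty$.
   Context: For $\pi\in\mathfrak{S}_n$ ($n\ge2$), $d(\pi)=\min_{1\le i<j\le n}\big(|i-j|+|\pi(i)-\pi(j)|\big)$. $\mathbf{Y}_n$ is the random variable $d(\pi)$ for $\pi\in\mathfrak{S}_n$ uniform. $\mathbf{Y}$ is the integer-valued random variable with $\Pr{\mathbf{Y}\ge d+2}=e^{-d^2-d}$ for every integer $d\ge0$ (so $\mathbf{Y}\ge2$ almost surely and $\Pr{\mathbf{Y}=d+2}=e^{-d^2-d}-e^{-(d+1)^2-(d+1)}$ for $d\ge0$). *)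

theory Defs
  imports "HOL-Analysis.Analysis" "HOL-Combinatorics.Permutations"
begin

definition perm_dist :: "nat \<Rightarrow> (nat \<Rightarrow> nat) \<Rightarrow> nat" where
  "perm_dist n \<pi> = Min {nat \<bar>int i - int j\<bar> + nat \<bar>int (\<pi> i) - int (\<pi> j)\<bar> | i j.
      i \<in> {1..n} \<and> j \<in> {1..n} \<and> i < j}"

definition moment_Yn :: "nat \<Rightarrow> nat \<Rightarrow> real" where
  "moment_Yn a n = (\<Sum>\<pi>\<in>{\<pi>. \<pi> permutes {1..n}}. real (perm_dist n \<pi>) ^ a)
                     / card {\<pi>. \<pi> permutes {1..n}}"

definition Y_pmf :: "nat \<Rightarrow> real" where
  "Y_pmf k = (if k < 2 then 0 else
     exp (- ((real (k - 2))^2) - real (k - 2)) - exp (- ((real (k - 1))^2) - real (k - 1)))"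

definition moment_Y :: "nat \<Rightarrow> real" where
  "moment_Y a = (\<Sum>k. real k ^ a * Y_pmf k)"

end

theory Submission
  imports Defs
begin

text \<open>
  Call two points of the grid close if they differ in both coordinates and have distance at most
  d + 1. Then d(\<pi>) \<ge> d + 2 holds iff the graph of \<pi> contains no close pair of points. There are
  asymptotically (d^2 + d) n^2 close pairs, each of which lies in the graph with probability about
  n^-2, and close pairs that share a point contribute only O(1/n); so the binomial moments of the
  number of close pairs in the graph converge to those of a Poisson variable with mean d^2 + d, and
  Bonferroni's inequalities give P(d(\<pi>) \<ge> d + 2) \<rightarrow> exp (- d^2 - d).

  For the moments a tail bound uniform in n is needed. Expose the values of \<pi> two at a time. As
  long as half of the values are unused, the next two values differ by at most d with conditional
  probability at least (d + 1) / (16 n); hence P(d(\<pi>) \<ge> d + 2) decays exponentially in d, and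
  Tannery's theorem applies.
\<close>

subsection \<open>Permutations extending a partial permutation\<close>

text \<open>The reference value for the j-th binomial moment is the number of j-element families of
  close pairs times \<open>fact (n - 2 * j) / fact n\<close>, exact for a family whose points lie in
  distinct rows and columns. Exceptional families come in two kinds. If two disjoint pairs meet a
  common row or column, the family lies in no graph, and there are too few such families to matter.
  If two pairs intersect, the union has fewer than 2j points, so the probability may be much larger
  than n^-2j and counting families is too crude. These are summed with the weight n^-(size of the
  union), under which attaching one more close pair costs only a constant factor.

  The limit for fixed d gives no control when d grows with n, because its error terms contain powers
  of (2d + 3)^2. The tail estimate is therefore separate and deliberately wasteful: it looks only at
  the adjacent positions 2s + 1 and 2s + 2. At least n/8 such pairs are exposed, each costing a
  factor 1 - (d + 1) / (16 n), whence the rate (d + 1) / 128.\<close>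

definition perms_through :: "nat \<Rightarrow> (nat \<times> nat) set \<Rightarrow> (nat \<Rightarrow> nat) set" where
  "perms_through n V = {\<pi>. \<pi> permutes {1..n} \<and> (\<forall>p\<in>V. \<pi> (fst p) = snd p)}"

text \<open>Non-attacking rook placements; the lemmas below show that these are exactly the sets of
  grid points that lie in the graph of some permutation.\<close>

definition partial_perm :: "nat \<Rightarrow> (nat \<times> nat) set \<Rightarrow> bool" where
  "partial_perm n V \<longleftrightarrow> V \<subseteq> {1..n} \<times> {1..n} \<and> inj_on fst V \<and> inj_on snd V"

lemma finite_perms_through [simp]: "finite (perms_through n V)"
  by (rule finite_subset[of _ "{\<pi>. \<pi> permutes {1..n}}"])
     (auto simp: perms_through_def finite_permutations)

lemma partial_perm_finite: "partial_perm n V \<Longrightarrow> finite V"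
  unfolding partial_perm_def by (meson finite_SigmaI finite_atLeastAtMost finite_subset)

lemma perms_through_partial_perm:
  assumes "\<pi> \<in> perms_through n V" "V \<subseteq> {1..n} \<times> {1..n}"
  shows "partial_perm n V"
proof -
  have inj: "inj \<pi>" using assms(1) by (auto simp: perms_through_def permutes_inj)
  have eq: "snd p = \<pi> (fst p)" if "p \<in> V" for p
    using assms(1) that by (auto simp: perms_through_def)
  have "inj_on fst V" by (rule inj_onI) (simp add: prod_eq_iff eq)
  moreover have "inj_on snd V" by (rule inj_onI) (simp add: prod_eq_iff eq inj_eq[OF inj])
  ultimately show ?thesis using assms(2) by (simp add: partial_perm_def)
qed

lemma card_perms_through_insert:
  assumes V: "partial_perm n (insert (i,u) V)" and new: "(i,u) \<notin> V"
  shows "card (perms_through n V) = (n - card V) * card (perms_through n (insert (i,u) V))"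
proof -
  have pV: "partial_perm n V" using V by (auto simp: partial_perm_def)
  have iu: "i \<in> {1..n}" "u \<in> {1..n}" using V by (auto simp: partial_perm_def)
  have i: "i \<notin> fst ` V" and u: "u \<notin> snd ` V"
    using V new by (auto simp: partial_perm_def)
  define R where "R = {1..n} - snd ` V"
  have cR: "card R = n - card V"
  proof -
    have "card (snd ` V) = card V" using pV by (auto simp: partial_perm_def card_image)
    moreover have "snd ` V \<subseteq> {1..n}" using pV by (auto simp: partial_perm_def)
    ultimately show ?thesis unfolding R_def by (simp add: card_Diff_subset finite_subset)
  qed
  have eq: "card (perms_through n (insert (i,u') V)) = card (perms_through n (insert (i,u) V))"
    if u': "u' \<in> R" for u'
  proof (rule bij_betw_same_card[of "\<lambda>\<pi>. Transposition.transpose u u' \<circ> \<pi>"])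
    \<comment> \<open>Stated with \<open>a\<close> and \<open>b\<close> interchangeable, since the
      transposition is its own inverse and both directions of the bijection are needed.\<close>
    have tt: "Transposition.transpose u u' \<circ> \<pi> \<in> perms_through n (insert (i,b) V)"
      if "\<pi> \<in> perms_through n (insert (i,a) V)" "a = u \<and> b = u' \<or> a = u' \<and> b = u" for \<pi> a b
    proof -
      have "Transposition.transpose u u' permutes {1..n}"
        using u' iu by (auto simp: R_def intro: permutes_swap_id)
      then have "(Transposition.transpose u u' \<circ> \<pi>) permutes {1..n}"
        using that by (auto simp: perms_through_def intro: permutes_compose)
      moreover have "Transposition.transpose u u' (snd p) = snd p" if "p \<in> V" for p
        using that u u' by (intro transpose_apply_other) (auto simp: R_def)
      ultimately show ?thesis using that by (auto simp: perms_through_def)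
    qed
    have inv: "Transposition.transpose u u' \<circ> (Transposition.transpose u u' \<circ> \<pi>) = \<pi>" for \<pi> :: "nat \<Rightarrow> nat"
      by (simp add: fun_eq_iff)
    show "bij_betw (\<lambda>\<pi>. Transposition.transpose u u' \<circ> \<pi>) (perms_through n (insert (i,u') V))
            (perms_through n (insert (i,u) V))"
      by (rule bij_betw_byWitness[where f' = "\<lambda>\<pi>. Transposition.transpose u u' \<circ> \<pi>"])
         (use tt in \<open>auto simp: inv\<close>)
  qed
  have "perms_through n V = (\<Union>u'\<in>R. perms_through n (insert (i,u') V))"
  proof (intro equalityI subsetI)
    fix \<pi> assume \<pi>: "\<pi> \<in> perms_through n V"
    then have p: "\<pi> permutes {1..n}" by (auto simp: perms_through_def)
    have "\<pi> i \<in> {1..n}" using iu permutes_in_image[OF p] by blast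
    moreover have "\<pi> i \<notin> snd ` V"
    proof
      assume "\<pi> i \<in> snd ` V"
      then obtain q where q: "q \<in> V" "\<pi> i = snd q" by auto
      then have "\<pi> i = \<pi> (fst q)" using \<pi> by (auto simp: perms_through_def)
      then show False using permutes_inj[OF p] q i by (auto dest: injD)
    qed
    ultimately show "\<pi> \<in> (\<Union>u'\<in>R. perms_through n (insert (i,u') V))"
      using \<pi> by (auto simp: R_def perms_through_def)
  qed (auto simp: perms_through_def)
  moreover have "perms_through n (insert (i,x) V) \<inter> perms_through n (insert (i,y) V) = {}" if "x \<noteq> y" for x y
    using that by (auto simp: perms_through_def)
  ultimately have "card (perms_through n V) = (\<Sum>u'\<in>R. card (perms_through n (insert (i,u') V)))"
    by (simp add: card_UN_disjoint R_def)
  also have "\<dots> = (n - card V) * card (perms_through n (insert (i,u) V))"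
    using eq cR by simp
  finally show ?thesis .
qed

lemma partial_perm_card_le:
  assumes "partial_perm n V" shows "card V \<le> n"
proof -
  have "card V = card (fst ` V)" using assms by (auto simp: partial_perm_def card_image)
  also have "\<dots> \<le> card {1..n}"
    by (intro card_mono) (use assms in \<open>auto simp: partial_perm_def\<close>)
  finally show ?thesis by simp
qed

lemma card_perms_through:
  assumes "partial_perm n V"
  shows "card (perms_through n V) = fact (n - card V)"
proof -
  have "finite V" using assms by (rule partial_perm_finite)
  then show ?thesis using assms
  proof (induction V rule: finite_induct)
    case empty
    then show ?case using card_permutations[of "{1..n}" n] by (simp add: perms_through_def)
  next
    case (insert p V)
    obtain i u where p: "p = (i,u)" by (cases p)
    have pV: "partial_perm n V" using insert.prems by (auto simp: partial_perm_def)
    have "card V < n" using partial_perm_card_le[OF insert.prems] insert.hyps by simp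
    then have "(n - card V) * fact (n - Suc (card V)) = (fact (n - card V) :: nat)"
      by (metis Suc_diff_Suc fact_Suc of_nat_id)
    also have "\<dots> = (n - card V) * card (perms_through n (insert p V))"
      using insert.IH[OF pV] card_perms_through_insert[of n i u V] insert.prems insert.hyps p by simp
    finally show ?case using \<open>card V < n\<close> insert.hyps by simp
  qed
qed

text \<open>Extends the count to point sets that need not be partial permutations: for those the
  left side is 0. This is what overlapping families of close pairs require.\<close>

lemma card_perms_through_le:
  assumes "V \<subseteq> {1..n} \<times> {1..n}"
  shows "card (perms_through n V) \<le> fact (n - card V)"
proof (cases "perms_through n V = {}")
  case False
  then show ?thesis using perms_through_partial_perm[OF _ assms] card_perms_through by fastforce
qed simp

subsection \<open>Close pairs of grid points\<close>

text \<open>Pairs in a common row or column are excluded because no graph of a permutation contains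
  them, while there are of order n^2 of them at small distance, which would falsify the count that
  becomes the Poisson mean. Unordered pairs are two-element sets, so the points of a family
  \<open>F\<close> are just the union of \<open>F\<close>.\<close>

definition close_pairs :: "nat \<Rightarrow> nat \<Rightarrow> (nat \<times> nat) set set" where
  "close_pairs d n = {{p, q} | p q. p \<in> {1..n} \<times> {1..n} \<and> q \<in> {1..n} \<times> {1..n} \<and>
     fst p \<noteq> fst q \<and> snd p \<noteq> snd q \<and>
     nat \<bar>int (fst p) - int (fst q)\<bar> + nat \<bar>int (snd p) - int (snd q)\<bar> \<le> d + 1}"

lemma close_pairs_subset_grid: "e \<in> close_pairs d n \<Longrightarrow> e \<subseteq> {1..n} \<times> {1..n}"
  by (auto simp: close_pairs_def)

lemma finite_close_pairs [simp]: "finite (close_pairs d n)"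
  by (rule finite_subset[of _ "Pow ({1..n} \<times> {1..n})"]) (auto simp: close_pairs_def)

lemma card_close_pair: "e \<in> close_pairs d n \<Longrightarrow> card e = 2"
  by (auto simp: close_pairs_def card_2_iff)

lemma finite_close_pair: "e \<in> close_pairs d n \<Longrightarrow> finite e"
  by (auto simp: close_pairs_def)

lemma partial_perm_close_pair: "e \<in> close_pairs d n \<Longrightarrow> partial_perm n e"
  by (auto simp: close_pairs_def partial_perm_def)

lemma perm_dist_ge_iff:
  assumes n: "n \<ge> 2" and \<pi>: "\<pi> permutes {1..n}"
  shows "perm_dist n \<pi> \<ge> d + 2 \<longleftrightarrow> (\<forall>e\<in>close_pairs d n. \<pi> \<notin> perms_through n e)"
proof -
  define c where "c i j = nat \<bar>int i - int j\<bar> + nat \<bar>int (\<pi> i) - int (\<pi> j)\<bar>" for i j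
  define S where "S = {c i j | i j. i \<in> {1..n} \<and> j \<in> {1..n} \<and> i < j}"
  have "S \<subseteq> (\<lambda>(i,j). c i j) ` ({1..n} \<times> {1..n})" by (auto simp: S_def)
  then have fin: "finite S" by (rule finite_subset) auto
  have "c 1 2 \<in> S" using n unfolding S_def by fastforce
  then have ne: "S \<noteq> {}" by blast
  have "perm_dist n \<pi> = Min S" by (simp add: perm_dist_def S_def c_def)
  then have 1: "perm_dist n \<pi> \<ge> d + 2 \<longleftrightarrow> (\<forall>i\<in>{1..n}. \<forall>j\<in>{1..n}. i < j \<longrightarrow> c i j \<ge> d + 2)"
    using Min_ge_iff[OF fin ne, of "d + 2"] unfolding S_def by (simp only:) blast
  have inj: "\<pi> i = \<pi> j \<longleftrightarrow> i = j" for i j using permutes_inj[OF \<pi>] by (simp add: inj_eq)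
  have im: "\<pi> i \<in> {1..n} \<longleftrightarrow> i \<in> {1..n}" for i by (rule permutes_in_image[OF \<pi>])
  have sym: "c i j = c j i" for i j by (simp add: c_def abs_minus_commute)
  show ?thesis
  proof
    assume L: "perm_dist n \<pi> \<ge> d + 2"
    show "\<forall>e\<in>close_pairs d n. \<pi> \<notin> perms_through n e"
    proof (intro ballI notI)
      fix e assume e: "e \<in> close_pairs d n" "\<pi> \<in> perms_through n e"
      then obtain p q where pq: "e = {p,q}" "fst p \<in> {1..n}" "fst q \<in> {1..n}" "fst p \<noteq> fst q"
        "nat \<bar>int (fst p) - int (fst q)\<bar> + nat \<bar>int (snd p) - int (snd q)\<bar> \<le> d + 1"
        by (auto simp: close_pairs_def)
      moreover have "snd p = \<pi> (fst p)" "snd q = \<pi> (fst q)"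
        using e(2) pq(1) by (auto simp: perms_through_def)
      ultimately have "c (fst p) (fst q) \<le> d + 1" by (simp add: c_def)
      moreover have "c (fst p) (fst q) \<ge> d + 2"
        using L 1 pq sym by (metis linorder_neqE_nat)
      ultimately show False by simp
    qed
  next
    assume R: "\<forall>e\<in>close_pairs d n. \<pi> \<notin> perms_through n e"
    have "c i j \<ge> d + 2" if ij: "i \<in> {1..n}" "j \<in> {1..n}" "i < j" for i j
    proof (rule ccontr)
      assume "\<not> ?thesis"
      then have "c i j \<le> d + 1" by simp
      then have "{(i, \<pi> i), (j, \<pi> j)} \<in> close_pairs d n"
        unfolding close_pairs_def c_def mem_Collect_eq
        using ij im[of i] im[of j] inj[of i j]
        by (intro exI[of _ "(i, \<pi> i)"] exI[of _ "(j, \<pi> j)"]) auto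
      moreover have "\<pi> \<in> perms_through n {(i, \<pi> i), (j, \<pi> j)}"
        using \<pi> by (auto simp: perms_through_def)
      ultimately show False using R by blast
    qed
    then show "perm_dist n \<pi> \<ge> d + 2" using 1 by blast
  qed
qed

lemma card_close_pairs_point:
  "card {e \<in> close_pairs d n. p \<in> e} \<le> (2 * d + 3)^2"
proof -
  \<comment> \<open>The truncated subtraction only shortens the interval near 0; it has at most 2d +
    3 elements, the source of the factor (2d + 3)^2 used throughout.\<close>
  define I where "I a = {a - (d + 1)..a + d + 1}" for a :: nat
  have "{e \<in> close_pairs d n. p \<in> e} \<subseteq> (\<lambda>q. {p,q}) ` (I (fst p) \<times> I (snd p))"
  proof
    fix e assume "e \<in> {e \<in> close_pairs d n. p \<in> e}"
    then obtain p' q' where pq: "e = {p',q'}" "p \<in> {p',q'}"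
      "nat \<bar>int (fst p') - int (fst q')\<bar> + nat \<bar>int (snd p') - int (snd q')\<bar> \<le> d + 1"
      by (auto simp: close_pairs_def)
    define q where "q = (if p = p' then q' else p')"
    have "e = {p,q}" using pq(1,2) by (auto simp: q_def)
    moreover have "nat \<bar>int (fst p) - int (fst q)\<bar> + nat \<bar>int (snd p) - int (snd q)\<bar> \<le> d + 1"
      using pq(2,3) by (auto simp: q_def abs_minus_commute)
    moreover from this have "fst q \<in> I (fst p)" "snd q \<in> I (snd p)"
      unfolding I_def by auto
    ultimately show "e \<in> (\<lambda>q. {p,q}) ` (I (fst p) \<times> I (snd p))"
      by (auto simp: mem_Times_iff)
  qed
  then have "card {e \<in> close_pairs d n. p \<in> e} \<le> card (I (fst p) \<times> I (snd p))"
    by (intro surj_card_le) (auto simp: I_def)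
  also have "\<dots> = card (I (fst p)) * card (I (snd p))" by (rule card_cartesian_product)
  also have "\<dots> \<le> (2 * d + 3) * (2 * d + 3)"
    by (intro mult_mono) (auto simp: I_def)
  finally show ?thesis by (simp add: power2_eq_square)
qed

lemma card_close_pairs_touching:
  assumes "finite P"
  shows "card {e \<in> close_pairs d n. e \<inter> P \<noteq> {}} \<le> card P * (2 * d + 3)^2"
proof -
  have "{e \<in> close_pairs d n. e \<inter> P \<noteq> {}} = (\<Union>p\<in>P. {e \<in> close_pairs d n. p \<in> e})" by auto
  then have "card {e \<in> close_pairs d n. e \<inter> P \<noteq> {}} \<le> (\<Sum>p\<in>P. card {e \<in> close_pairs d n. p \<in> e})"
    using card_UN_le[OF assms] by metis
  also have "\<dots> \<le> (\<Sum>p\<in>P. (2 * d + 3)^2)" by (intro sum_mono card_close_pairs_point)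
  finally show ?thesis by simp
qed

text \<open>A close pair touches the whole grid, so the bound per point suffices. This crude form
  serves in all error terms; the exact count is needed only for the main term.\<close>

lemma card_close_pairs_le: "card (close_pairs d n) \<le> n^2 * (2 * d + 3)^2"
proof -
  have "e \<inter> ({1..n} \<times> {1..n}) \<noteq> {}" if "e \<in> close_pairs d n" for e
    using close_pairs_subset_grid[OF that] card_close_pair[OF that] by (auto simp: inf_absorb1)
  then have "{e \<in> close_pairs d n. e \<inter> ({1..n} \<times> {1..n}) \<noteq> {}} = close_pairs d n"
    by blast
  moreover have "card ({1..n} \<times> {1..n}) = n^2" by (simp add: power2_eq_square)
  moreover have "finite ({1..n} \<times> {1..n})" by simp
  note card_close_pairs_touching[OF this, of d n]
  ultimately show ?thesis by (simp only:)
qed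

text \<open>Normal form: a close pair is one of the two diagonals of an r by s box with corner (i,
  u).\<close>

lemma close_pairs_cases:
  assumes "e \<in> close_pairs d n"
  obtains i u r s where "r \<ge> 1" "s \<ge> 1" "r + s \<le> d + 1" "i \<ge> 1" "u \<ge> 1" "i + r \<le> n" "u + s \<le> n"
    "e = {(i,u),(i+r,u+s)} \<or> e = {(i,u+s),(i+r,u)}"
proof -
  note intro = that
  have *: thesis if "e = {p,q}" "p \<in> {1..n} \<times> {1..n}" "q \<in> {1..n} \<times> {1..n}" "fst p < fst q" "snd p \<noteq> snd q"
     "nat \<bar>int (fst p) - int (fst q)\<bar> + nat \<bar>int (snd p) - int (snd q)\<bar> \<le> d + 1" for p q
  proof (cases "snd p < snd q")
    case True
    show ?thesis
      by (rule intro[of "fst q - fst p" "snd q - snd p" "fst p" "snd p"])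
         (use that True in \<open>auto simp: mem_Times_iff prod_eq_iff\<close>)
  next
    case False
    show ?thesis
      by (rule intro[of "fst q - fst p" "snd p - snd q" "fst p" "snd q"])
         (use that False in \<open>auto simp: mem_Times_iff prod_eq_iff\<close>)
  qed
  obtain p q where pq: "e = {p,q}" "p \<in> {1..n} \<times> {1..n}" "q \<in> {1..n} \<times> {1..n}"
     "fst p \<noteq> fst q" "snd p \<noteq> snd q"
     "nat \<bar>int (fst p) - int (fst q)\<bar> + nat \<bar>int (snd p) - int (snd q)\<bar> \<le> d + 1"
    using assms unfolding close_pairs_def by blast
  show ?thesis
  proof (cases "fst p < fst q")
    case True
    then show ?thesis using *[of p q] pq by blast
  next
    case False
    then show ?thesis using *[of q p] pq by (simp add: insert_commute abs_minus_commute)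
  qed
qed

text \<open>A box of shape (r, s) has (n - r)(n - s) positions in the grid and two diagonals. Both
  sides being at least 1, the box and the diagonal can be recovered from the pair. Truncated
  subtraction gives 0 when the box does not fit.\<close>

lemma card_close_pairs:
  "card (close_pairs d n) =
    (\<Sum>(r,s)\<in>(SIGMA r:{1..d}. {1..d + 1 - r}). 2 * ((n - r) * (n - s)))"
proof -
  define D where "D = (SIGMA r:{1..d}. {1..d + 1 - r})"
  define f :: "((nat \<times> nat) \<times> bool) \<times> (nat \<times> nat) \<Rightarrow> (nat \<times> nat) set" where
    "f = (\<lambda>(((r,s),b),(i,u)). if b then {(i,u),(i+r,u+s)} else {(i,u+s),(i+r,u)})"
  define Q where "Q = (SIGMA x:D \<times> (UNIV :: bool set). {1..n - fst (fst x)} \<times> {1..n - snd (fst x)})"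
  have "inj_on f Q"
  proof (rule inj_onI)
    fix x y assume xy: "x \<in> Q" "y \<in> Q" "f x = f y"
    obtain r s b i u where x: "x = (((r,s),b),(i,u))" by (metis surj_pair)
    obtain r' s' b' i' u' where y: "y = (((r',s'),b'),(i',u'))" by (metis surj_pair)
    have "r \<ge> 1" "s \<ge> 1" "r' \<ge> 1" "s' \<ge> 1" using xy x y by (auto simp: Q_def D_def)
    then show "x = y"
      using xy(3) unfolding x y f_def
      by (cases b; cases b'; simp add: doubleton_eq_iff; linarith?)
  qed
  moreover have "f ` Q = close_pairs d n"
  proof (intro equalityI subsetI)
    fix e assume "e \<in> f ` Q"
    then obtain r s b i u where x: "(r,s) \<in> D" "i \<in> {1..n-r}" "u \<in> {1..n-s}" "e = f (((r,s),b),(i,u))"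
      by (auto simp: Q_def)
    have rs: "r \<ge> 1" "s \<ge> 1" "r + s \<le> d + 1" using x by (auto simp: D_def)
    have "e = {(i,u),(i+r,u+s)} \<or> e = {(i,u+s),(i+r,u)}" using x by (auto simp: f_def)
    then show "e \<in> close_pairs d n"
    proof
      assume "e = {(i,u),(i+r,u+s)}"
      then show ?thesis unfolding close_pairs_def mem_Collect_eq
        by (intro exI[of _ "(i,u)"] exI[of _ "(i+r,u+s)"]) (use x rs in auto)
    next
      assume "e = {(i,u+s),(i+r,u)}"
      then show ?thesis unfolding close_pairs_def mem_Collect_eq
        by (intro exI[of _ "(i,u+s)"] exI[of _ "(i+r,u)"]) (use x rs in auto)
    qed
  next
    fix e assume "e \<in> close_pairs d n"
    then obtain i u r s where x: "r \<ge> 1" "s \<ge> 1" "r + s \<le> d + 1" "i \<ge> 1" "u \<ge> 1" "i + r \<le> n" "u + s \<le> n"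
      and e: "e = {(i,u),(i+r,u+s)} \<or> e = {(i,u+s),(i+r,u)}"
      by (rule close_pairs_cases)
    have "(((r,s),b),(i,u)) \<in> Q" for b using x by (auto simp: Q_def D_def)
    moreover have "e = f (((r,s),True),(i,u)) \<or> e = f (((r,s),False),(i,u))"
      using e by (simp add: f_def)
    ultimately show "e \<in> f ` Q" by blast
  qed
  ultimately have "card (close_pairs d n) = card Q" by (metis card_image)
  also have "\<dots> = (\<Sum>x\<in>D \<times> (UNIV :: bool set). (n - fst (fst x)) * (n - snd (fst x)))"
    unfolding Q_def by (subst card_SigmaI) (auto simp: D_def card_cartesian_product)
  also have "\<dots> = (\<Sum>y\<in>D. \<Sum>b\<in>(UNIV :: bool set). (n - fst y) * (n - snd y))"
    by (subst sum.cartesian_product) (simp add: case_prod_unfold)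
  also have "\<dots> = (\<Sum>(r,s)\<in>D. 2 * ((n - r) * (n - s)))"
    by (simp add: case_prod_unfold UNIV_bool mult_2)
  finally show ?thesis by (simp only: D_def)
qed

text \<open>There are d(d + 1)/2 shapes with r, s at least 1 and r + s at most d + 1, each
  contributing asymptotically 2 n^2 pairs.\<close>

lemma card_close_pairs_limit:
  "(\<lambda>n. real (card (close_pairs d n)) / real n ^ 2) \<longlonglongrightarrow> real d ^ 2 + real d"
proof -
  define D where "D = (SIGMA r:{1..d}. {1..d + 1 - r})"
  have l1: "(\<lambda>n. real (n - r) / real n) \<longlonglongrightarrow> 1" for r
  proof (rule Lim_transform_eventually)
    have "(\<lambda>n. 1 - real r * (1 / real n)) \<longlonglongrightarrow> 1 - real r * 0"
      by (intro tendsto_intros lim_1_over_n)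
    then show "(\<lambda>n. 1 - real r * (1 / real n)) \<longlonglongrightarrow> 1" by simp
    show "\<forall>\<^sub>F n in sequentially. 1 - real r * (1 / real n) = real (n - r) / real n"
      using eventually_ge_at_top[of "r + 1"]
      by eventually_elim (auto simp: field_simps of_nat_diff)
  qed
  have "(\<lambda>n. \<Sum>x\<in>D. 2 * (real (n - fst x) / real n * (real (n - snd x) / real n)))
          \<longlonglongrightarrow> (\<Sum>x\<in>D. 2 * (1 * 1))"
    by (intro tendsto_intros l1)
  moreover have "(\<Sum>x\<in>D. 2 * (1 * 1)) = real d ^ 2 + real d"
  proof -
    have "card D = (\<Sum>r=1..d. d + 1 - r)" by (simp add: D_def)
    also have "\<dots> = (\<Sum>r=1..d. r)"
      by (rule sum.reindex_bij_witness[of _ "\<lambda>r. d + 1 - r" "\<lambda>r. d + 1 - r"]) auto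
    also have "real \<dots> = real d * (real d + 1) / 2"
      by (induction d) (auto simp: field_simps)
    finally show ?thesis by (simp add: power2_eq_square algebra_simps)
  qed
  moreover have "real (card (close_pairs d n)) / real n ^ 2
      = (\<Sum>x\<in>D. 2 * (real (n - fst x) / real n * (real (n - snd x) / real n)))" for n
    unfolding card_close_pairs D_def[symmetric]
    by (simp add: case_prod_unfold sum_divide_distrib power2_eq_square)
  ultimately show ?thesis by simp
qed

subsection \<open>Binomial moments of the number of close pairs\<close>

abbreviation subsets_card :: "'a set \<Rightarrow> nat \<Rightarrow> 'a set set" where
  "subsets_card E m \<equiv> {F. F \<subseteq> E \<and> card F = m}"

text \<open>Removing any element writes a set of size m + 1 as \<open>insert e F\<close>; the right
  side counts it repeatedly, which is harmless for nonnegative \<open>g\<close>. This permits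
  building families one close pair at a time.\<close>

lemma sum_subsets_card_Suc_le:
  fixes g :: "'a set \<Rightarrow> real"
  assumes E: "finite E" and g: "\<And>F. g F \<ge> 0"
  shows "(\<Sum>F\<in>subsets_card E (Suc m). g F) \<le> (\<Sum>F\<in>subsets_card E m. \<Sum>e\<in>E. g (insert e F))"
proof -
  have fin: "finite (subsets_card E k)" for k
    using E by (intro finite_subset[OF _ finite_Pow_iff[THEN iffD2, OF E]]) auto
  define h where "h = (\<lambda>(F, e). insert e F :: 'a set)"
  have "subsets_card E (Suc m) \<subseteq> h ` (subsets_card E m \<times> E)"
  proof
    fix F assume F: "F \<in> subsets_card E (Suc m)"
    then obtain e where e: "e \<in> F" by force
    have "finite F" using F E finite_subset by auto
    then have "(F - {e}, e) \<in> subsets_card E m \<times> E" using F e by auto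
    moreover have "F = h (F - {e}, e)" using e by (auto simp: h_def)
    ultimately show "F \<in> h ` (subsets_card E m \<times> E)" by blast
  qed
  then have "(\<Sum>F\<in>subsets_card E (Suc m). g F) \<le> (\<Sum>F\<in>h ` (subsets_card E m \<times> E). g F)"
    using fin E g by (intro sum_mono2) auto
  also have "\<dots> \<le> (\<Sum>x\<in>subsets_card E m \<times> E. g (h x))"
    using sum_image_le[of "subsets_card E m \<times> E" g h] fin E g by (simp add: o_def)
  also have "\<dots> = (\<Sum>F\<in>subsets_card E m. \<Sum>e\<in>E. g (insert e F))"
    by (simp add: sum.cartesian_product h_def case_prod_unfold)
  finally show ?thesis .
qed

text \<open>The same overcounting, with a related pair singled out first. It is applied to
  intersecting pairs with a size-dependent weight, and to pairs sharing a line with weight 1. For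
  \<open>m < 2\<close> the left sum is empty.\<close>

lemma sum_subsets_card_related_le:
  fixes g :: "'a set \<Rightarrow> real"
  assumes E: "finite E" and g: "\<And>F. g F \<ge> 0"
  shows "(\<Sum>F | F \<in> subsets_card E m \<and> (\<exists>x\<in>F. \<exists>y\<in>F. y \<noteq> x \<and> P x y). g F)
    \<le> (\<Sum>x\<in>E. \<Sum>y | y \<in> E \<and> y \<noteq> x \<and> P x y. \<Sum>F\<in>subsets_card E (m - 2). g ({x, y} \<union> F))"
proof -
  have fin: "finite (subsets_card E k)" for k
    using E by (intro finite_subset[OF _ finite_Pow_iff[THEN iffD2, OF E]]) auto
  define I where "I = (SIGMA x:E. {y. y \<in> E \<and> y \<noteq> x \<and> P x y} \<times> subsets_card E (m - 2))"
  define h where "h = (\<lambda>(x, y, F). {x, y} \<union> F :: 'a set)"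
  have finI: "finite I" using E fin by (auto simp: I_def)
  have "{F \<in> subsets_card E m. \<exists>x\<in>F. \<exists>y\<in>F. y \<noteq> x \<and> P x y} \<subseteq> h ` I"
  proof
    fix F assume "F \<in> {F \<in> subsets_card E m. \<exists>x\<in>F. \<exists>y\<in>F. y \<noteq> x \<and> P x y}"
    then obtain x y where xy: "F \<subseteq> E" "card F = m" "x \<in> F" "y \<in> F" "y \<noteq> x" "P x y" by blast
    have "finite F" using xy E finite_subset by auto
    then have "card (F - {x,y}) = m - 2" using xy by (subst card_Diff_subset) auto
    then have "(x, y, F - {x,y}) \<in> I" using xy by (auto simp: I_def)
    moreover have "F = h (x, y, F - {x,y})" using xy by (auto simp: h_def)
    ultimately show "F \<in> h ` I" by blast
  qed
  then have "(\<Sum>F | F \<in> subsets_card E m \<and> (\<exists>x\<in>F. \<exists>y\<in>F. y \<noteq> x \<and> P x y). g F) \<le> (\<Sum>F\<in>h ` I. g F)"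
    using finI g by (intro sum_mono2) auto
  also have "\<dots> \<le> (\<Sum>x\<in>I. g (h x))"
    using sum_image_le[of I g h] finI g by (simp add: o_def)
  also have "\<dots> = (\<Sum>x\<in>E. \<Sum>y | y \<in> E \<and> y \<noteq> x \<and> P x y. \<Sum>F\<in>subsets_card E (m - 2). g ({x, y} \<union> F))"
  proof -
    have "(\<Sum>x\<in>E. \<Sum>y | y \<in> E \<and> y \<noteq> x \<and> P x y. \<Sum>F\<in>subsets_card E (m - 2). g ({x, y} \<union> F))
      = (\<Sum>x\<in>E. \<Sum>z\<in>{y. y \<in> E \<and> y \<noteq> x \<and> P x y} \<times> subsets_card E (m - 2). g (h (x, z)))"
      by (simp add: sum.cartesian_product h_def case_prod_unfold)
    also have "\<dots> = (\<Sum>x\<in>I. g (h x))"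
      unfolding I_def using E fin by (subst sum.Sigma) (auto simp: case_prod_unfold)
    finally show ?thesis by simp
  qed
  finally show ?thesis .
qed

section \<open>Weighted sums over families of close pairs\<close>

lemma card_Union_close_pairs_le:
  assumes "F \<subseteq> close_pairs d n"
  shows "card (\<Union>F) \<le> 2 * card F"
proof -
  have "card (\<Union>F) \<le> sum card F" by (rule card_Union_le_sum_card)
  also have "\<dots> = (\<Sum>e\<in>F. 2)" using assms by (intro sum.cong) (auto intro: card_close_pair)
  finally show ?thesis by simp
qed

lemma finite_Union_close_pairs: "F \<subseteq> close_pairs d n \<Longrightarrow> finite (\<Union>F)"
  by (rule finite_subset[of _ "{1..n} \<times> {1..n}"]) (use close_pairs_subset_grid in blast, simp)

text \<open>Two effects balance: close pairs touching \<open>V\<close> may add no factor 1/n^2, but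
  their number is bounded independently of n; the O(n^2) pairs disjoint from \<open>V\<close> add
  two points and hence a factor 1/n^2. So attaching a close pair costs O(1).\<close>

lemma sum_close_pairs_weight_le:
  fixes n :: nat
  assumes n: "n \<ge> 1" and V: "finite V"
  shows "(\<Sum>e\<in>close_pairs d n. 1 / real n ^ card (V \<union> e))
     \<le> (1 + real (card V)) * (2 * real d + 3)^2 / real n ^ card V"
proof -
  define K where "K = (2 * real d + 3)^2"
  define A where "A = {e \<in> close_pairs d n. e \<inter> V \<noteq> {}}"
  define B where "B = {e \<in> close_pairs d n. e \<inter> V = {}}"
  have "(\<Sum>e\<in>close_pairs d n. 1 / real n ^ card (V \<union> e))
      = (\<Sum>e\<in>A. 1 / real n ^ card (V \<union> e)) + (\<Sum>e\<in>B. 1 / real n ^ card (V \<union> e))"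
    by (subst sum.union_disjoint[symmetric]) (auto simp: A_def B_def intro!: sum.cong)
  also have "(\<Sum>e\<in>A. 1 / real n ^ card (V \<union> e)) \<le> (\<Sum>e\<in>A. 1 / real n ^ card V)"
  proof (rule sum_mono)
    fix e assume "e \<in> A"
    then have "card V \<le> card (V \<union> e)"
      using V finite_close_pair by (intro card_mono) (auto simp: A_def)
    then show "1 / real n ^ card (V \<union> e) \<le> 1 / real n ^ card V"
      using n by (intro divide_left_mono power_increasing) auto
  qed
  also have "\<dots> = real (card A) / real n ^ card V" by simp
  also have "\<dots> \<le> real (card V) * K / real n ^ card V"
  proof (rule divide_right_mono)
    have "real (card A) \<le> real (card V * (2 * d + 3)^2)"
      unfolding of_nat_le_iff A_def by (rule card_close_pairs_touching[OF V])
    then show "real (card A) \<le> real (card V) * K" by (simp add: K_def)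
  qed simp
  also have "(\<Sum>e\<in>B. 1 / real n ^ card (V \<union> e)) = (\<Sum>e\<in>B. 1 / real n ^ (card V + 2))"
  proof (rule sum.cong)
    fix e assume "e \<in> B"
    then have "card (V \<union> e) = card V + 2"
      using V finite_close_pair[of e d n] card_close_pair[of e d n]
      by (subst card_Un_disjoint) (auto simp: B_def)
    then show "1 / real n ^ card (V \<union> e) = 1 / real n ^ (card V + 2)" by simp
  qed simp
  also have "\<dots> = real (card B) / real n ^ (card V + 2)" by simp
  also have "\<dots> \<le> (real n ^ 2 * K) / real n ^ (card V + 2)"
  proof (rule divide_right_mono)
    have "card B \<le> card (close_pairs d n)" by (intro card_mono) (auto simp: B_def)
    also have "\<dots> \<le> n^2 * (2 * d + 3)^2" by (rule card_close_pairs_le)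
    finally have "real (card B) \<le> real (n^2 * (2 * d + 3)^2)" unfolding of_nat_le_iff .
    then show "real (card B) \<le> real n ^ 2 * K" by (simp add: K_def)
  qed simp
  also have "\<dots> = K / real n ^ card V" using n by (simp add: power_add power2_eq_square)
  finally show ?thesis by (simp add: K_def add_divide_distrib distrib_right)
qed

lemma sum_close_pairs_subsets_weight_le:
  fixes n :: nat
  assumes n: "n \<ge> 1" and V: "finite V"
  shows "(\<Sum>F\<in>subsets_card (close_pairs d n) m. 1 / real n ^ card (V \<union> \<Union>F))
     \<le> ((1 + real (card V) + 2 * real m) * (2 * real d + 3)^2) ^ m / real n ^ card V"
proof -
  define E where "E = close_pairs d n"
  define K where "K = (2 * real d + 3)^2"
  define C where "C = (1 + real (card V) + 2 * real m) * K"
  have C0: "C \<ge> 0" by (simp add: C_def K_def)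
  \<comment> \<open>The induction runs over \<open>k\<close> with \<open>m\<close> fixed, so that
    one constant \<open>C\<close> bounds every step: the union never exceeds
    \<open>card V + 2 * m\<close> points.\<close>
  have "(\<Sum>F\<in>subsets_card E k. 1 / real n ^ card (V \<union> \<Union>F)) \<le> C ^ k / real n ^ card V" if "k \<le> m" for k
    using that
  proof (induction k)
    case 0
    have "subsets_card E 0 = {{}}"
      by (auto simp: E_def) (metis card_0_eq finite_close_pairs finite_subset equals0D)
    then show ?case by simp
  next
    case (Suc k)
    have "(\<Sum>F\<in>subsets_card E (Suc k). 1 / real n ^ card (V \<union> \<Union>F))
      \<le> (\<Sum>F\<in>subsets_card E k. \<Sum>e\<in>E. 1 / real n ^ card (V \<union> \<Union>(insert e F)))"
      by (rule sum_subsets_card_Suc_le) (auto simp: E_def)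
    also have "\<dots> \<le> (\<Sum>F\<in>subsets_card E k. C * (1 / real n ^ card (V \<union> \<Union>F)))"
    proof (rule sum_mono)
      fix F assume F: "F \<in> subsets_card E k"
      define W where "W = V \<union> \<Union>F"
      have W: "finite W" using F V finite_Union_close_pairs[of F d n] by (auto simp: W_def E_def)
      have "card W \<le> card V + card (\<Union>F)" unfolding W_def by (rule card_Un_le)
      also have "card (\<Union>F) \<le> 2 * k" using card_Union_close_pairs_le[of F d n] F by (auto simp: E_def)
      finally have cW: "card W \<le> card V + 2 * m" using Suc.prems by simp
      have "(\<Sum>e\<in>E. 1 / real n ^ card (V \<union> \<Union>(insert e F))) = (\<Sum>e\<in>E. 1 / real n ^ card (W \<union> e))"
        by (intro sum.cong refl arg_cong[where f = "\<lambda>A. 1 / real n ^ card A"]) (auto simp: W_def)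
      also have "\<dots> \<le> (1 + real (card W)) * K / real n ^ card W"
        unfolding E_def K_def by (rule sum_close_pairs_weight_le[OF n W])
      also have "\<dots> \<le> C / real n ^ card W"
        unfolding C_def using cW by (intro divide_right_mono mult_right_mono) (auto simp: K_def)
      finally show "(\<Sum>e\<in>E. 1 / real n ^ card (V \<union> \<Union>(insert e F))) \<le> C * (1 / real n ^ card (V \<union> \<Union>F))"
        by (simp add: W_def)
    qed
    also have "\<dots> = C * (\<Sum>F\<in>subsets_card E k. 1 / real n ^ card (V \<union> \<Union>F))"
      by (simp add: sum_distrib_left)
    also have "\<dots> \<le> C * (C ^ k / real n ^ card V)"
      using Suc C0 by (intro mult_left_mono) auto
    finally show ?case by simp
  qed
  from this[of m] show ?thesis by (simp add: E_def C_def K_def)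
qed

lemma card_Un_intersecting_close_pairs:
  assumes "e \<in> close_pairs d n" "e' \<in> close_pairs d n" "e' \<noteq> e" "e' \<inter> e \<noteq> {}"
  shows "card (e \<union> e') = 3"
proof -
  have fin: "finite e" "finite e'" and c: "card e = 2" "card e' = 2"
    using assms finite_close_pair card_close_pair by blast+
  have "card (e \<inter> e') \<noteq> 0" using fin assms by auto
  moreover have "card (e \<inter> e') < 2"
  proof (rule ccontr)
    assume "\<not> ?thesis"
    then have "e \<inter> e' = e" "e \<inter> e' = e'"
      using c card_seteq[OF fin(1), of "e \<inter> e'"] card_seteq[OF fin(2), of "e \<inter> e'"] by auto
    then show False using assms by auto
  qed
  ultimately show ?thesis using card_Un_Int[OF fin] c by simp
qed

text \<open>Two distinct intersecting close pairs cover three points, so they carry weight n^-3,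
  while there are only O(n^2) such couples. The other m - 2 pairs cost constant factors, and O(1/n)
  remains.\<close>

lemma sum_intersecting_weight_le:
  fixes n :: nat
  assumes n: "n \<ge> 1"
  shows "(\<Sum>F | F \<in> subsets_card (close_pairs d n) m \<and> (\<exists>e\<in>F. \<exists>e'\<in>F. e' \<noteq> e \<and> e' \<inter> e \<noteq> {}).
            1 / real n ^ card (\<Union>F))
     \<le> 2 * ((2 * real d + 3)^2)^2 * ((4 + 2 * real (m - 2)) * (2 * real d + 3)^2) ^ (m - 2) / real n"
proof -
  define E where "E = close_pairs d n"
  define K where "K = (2 * real d + 3)^2"
  \<comment> \<open>The 4 is 1 + 3, the three points of the intersecting couple playing the part of
    \<open>V\<close>.\<close>
  define L where "L = ((4 + 2 * real (m - 2)) * K) ^ (m - 2)"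
  have L0: "L \<ge> 0" by (simp add: L_def K_def)
  have "(\<Sum>F | F \<in> subsets_card E m \<and> (\<exists>e\<in>F. \<exists>e'\<in>F. e' \<noteq> e \<and> e' \<inter> e \<noteq> {}). 1 / real n ^ card (\<Union>F))
    \<le> (\<Sum>e\<in>E. \<Sum>e' | e' \<in> E \<and> e' \<noteq> e \<and> e' \<inter> e \<noteq> {}.
          \<Sum>F\<in>subsets_card E (m - 2). 1 / real n ^ card (\<Union>({e,e'} \<union> F)))"
    by (rule sum_subsets_card_related_le) (auto simp: E_def)
  also have "\<dots> \<le> (\<Sum>e\<in>E. \<Sum>e' | e' \<in> E \<and> e' \<noteq> e \<and> e' \<inter> e \<noteq> {}. L / real n ^ 3)"
  proof (intro sum_mono)
    fix e e' assume e: "e \<in> E" "e' \<in> {e' \<in> E. e' \<noteq> e \<and> e' \<inter> e \<noteq> {}}"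
    then have "card (e \<union> e') = 3" "finite (e \<union> e')"
      using card_Un_intersecting_close_pairs[of e d n e'] finite_close_pair by (auto simp: E_def)
    moreover have "(\<Sum>F\<in>subsets_card E (m - 2). 1 / real n ^ card (\<Union>({e,e'} \<union> F)))
        = (\<Sum>F\<in>subsets_card E (m - 2). 1 / real n ^ card ((e \<union> e') \<union> \<Union>F))"
      by (simp add: Un_assoc)
    ultimately show "(\<Sum>F\<in>subsets_card E (m - 2). 1 / real n ^ card (\<Union>({e,e'} \<union> F))) \<le> L / real n ^ 3"
      using sum_close_pairs_subsets_weight_le[OF n, of "e \<union> e'" d "m - 2"] by (simp add: E_def L_def K_def)
  qed
  also have "\<dots> = (\<Sum>e\<in>E. real (card {e' \<in> E. e' \<noteq> e \<and> e' \<inter> e \<noteq> {}}) * (L / real n ^ 3))" by simp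
  also have "\<dots> \<le> (\<Sum>e\<in>E. (2 * K) * (L / real n ^ 3))"
  proof (intro sum_mono mult_right_mono)
    fix e assume e: "e \<in> E"
    have "card {e' \<in> E. e' \<noteq> e \<and> e' \<inter> e \<noteq> {}} \<le> card {e' \<in> E. e' \<inter> e \<noteq> {}}"
      by (intro card_mono) (auto simp: E_def)
    also have "\<dots> \<le> card e * (2 * d + 3)^2"
      unfolding E_def using e by (intro card_close_pairs_touching) (auto simp: E_def finite_close_pair)
    finally have "card {e' \<in> E. e' \<noteq> e \<and> e' \<inter> e \<noteq> {}} \<le> 2 * (2 * d + 3)^2"
      using e card_close_pair by (simp add: E_def)
    then have "real (card {e' \<in> E. e' \<noteq> e \<and> e' \<inter> e \<noteq> {}}) \<le> real (2 * (2 * d + 3)^2)"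
      unfolding of_nat_le_iff .
    then show "real (card {e' \<in> E. e' \<noteq> e \<and> e' \<inter> e \<noteq> {}}) \<le> 2 * K" by (simp add: K_def)
  qed (use L0 in auto)
  also have "\<dots> = real (card E) * ((2 * K) * (L / real n ^ 3))" by simp
  also have "\<dots> \<le> (real n ^ 2 * K) * ((2 * K) * (L / real n ^ 3))"
  proof (rule mult_right_mono)
    have "real (card E) \<le> real (n^2 * (2 * d + 3)^2)"
      unfolding of_nat_le_iff E_def by (rule card_close_pairs_le)
    then show "real (card E) \<le> real n ^ 2 * K" by (simp add: K_def)
  qed (use L0 in \<open>auto simp: K_def\<close>)
  also have "\<dots> = 2 * K^2 * L / real n"
    using n by (simp add: power2_eq_square power3_eq_cube)
  finally show ?thesis by (simp add: E_def L_def K_def)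
qed

text \<open>The obstruction to a union of close pairs being a partial permutation. Intersecting
  pairs share a line; the disjoint ones that do are those that cannot occur together in a
  graph.\<close>

definition share_line :: "(nat \<times> nat) set \<Rightarrow> (nat \<times> nat) set \<Rightarrow> bool" where
  "share_line e e' \<longleftrightarrow> (\<exists>p\<in>e. \<exists>p'\<in>e'. fst p = fst p' \<or> snd p = snd p')"

text \<open>The rows and columns through the two points of \<open>e\<close> contain at most 4n grid
  points. The bound is O(n), against O(n^2) close pairs altogether.\<close>

lemma card_share_line_le:
  assumes e: "e \<in> close_pairs d n"
  shows "card {e' \<in> close_pairs d n. share_line e e'} \<le> 4 * n * (2 * d + 3)^2"
proof -
  define P where "P = fst ` e \<times> {1..n} \<union> {1..n} \<times> snd ` e"
  have fe: "finite e" using e finite_close_pair by blast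
  have P: "finite P" using fe by (simp add: P_def)
  have sub: "{e' \<in> close_pairs d n. share_line e e'} \<subseteq> {e' \<in> close_pairs d n. e' \<inter> P \<noteq> {}}"
  proof
    fix e' assume e': "e' \<in> {e' \<in> close_pairs d n. share_line e e'}"
    then obtain q p where "q \<in> e" "fst q = fst p \<or> snd q = snd p" and p: "p \<in> e'"
      unfolding share_line_def by blast
    then have "fst p \<in> fst ` e \<or> snd p \<in> snd ` e" by (metis imageI)
    moreover have "p \<in> {1..n} \<times> {1..n}" using p e' close_pairs_subset_grid by blast
    ultimately have "p \<in> P" by (auto simp: P_def mem_Times_iff)
    then show "e' \<in> {e' \<in> close_pairs d n. e' \<inter> P \<noteq> {}}" using e' p by blast
  qed
  have "card P \<le> card (fst ` e \<times> {1..n}) + card ({1..n} \<times> snd ` e)" unfolding P_def by (rule card_Un_le)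
  also have "\<dots> \<le> 2 * n + n * 2"
    using card_image_le[OF fe, of fst] card_image_le[OF fe, of snd] card_close_pair[OF e]
    unfolding card_cartesian_product by (intro add_mono mult_mono) auto
  finally have cP: "card P \<le> 4 * n" by simp
  have "card {e' \<in> close_pairs d n. share_line e e'} \<le> card {e' \<in> close_pairs d n. e' \<inter> P \<noteq> {}}"
    by (rule card_mono[OF _ sub]) simp
  also have "\<dots> \<le> card P * (2 * d + 3)^2" by (rule card_close_pairs_touching[OF P])
  also have "\<dots> \<le> 4 * n * (2 * d + 3)^2" using cP by (rule mult_right_mono) simp
  finally show ?thesis .
qed

section \<open>Factorial quotients, binomial coefficients and counts of families\<close>

lemma card_subsets_card_le: "finite E \<Longrightarrow> card (subsets_card E m) \<le> card E ^ m"
  by (cases "m \<le> card E") (simp_all add: n_subsets binomial_le_pow binomial_eq_0)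

lemma power_times_fact_diff_limit:
  "(\<lambda>n. real n ^ m * (fact (n - m) / fact n)) \<longlonglongrightarrow> 1"
proof (induction m)
  case (Suc m)
  have "(\<lambda>n. 1 / (1 - real m * (1 / real n))) \<longlonglongrightarrow> 1 / (1 - real m * 0)"
    by (intro tendsto_intros lim_1_over_n) auto
  then have "(\<lambda>n. real n ^ m * (fact (n - m) / fact n) * (1 / (1 - real m * (1 / real n)))) \<longlonglongrightarrow> 1 * 1"
    using Suc.IH by (intro tendsto_mult) auto
  moreover have "\<forall>\<^sub>F n in sequentially.
      real n ^ m * (fact (n - m) / fact n) * (1 / (1 - real m * (1 / real n)))
      = real n ^ Suc m * (fact (n - Suc m) / fact n)"
    using eventually_gt_at_top[of m]
  proof eventually_elim
    case (elim n)
    then have "fact (n - m) = (real n - real m) * fact (n - Suc m)"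
      by (metis Suc_diff_Suc fact_Suc of_nat_diff less_imp_le)
    moreover have "1 / (1 - real m * (1 / real n)) = real n / (real n - real m)"
      using elim by (simp add: field_simps)
    ultimately show ?case using elim by simp
  qed
  ultimately show ?case using Lim_transform_eventually by fastforce
qed simp

text \<open>Each of the m factors of \<open>fact n / fact (n - m)\<close> is at least n/2. An
  inequality rather than a limit is wanted here, because the size of the union varies with the
  family.\<close>

lemma fact_diff_div_fact_le:
  assumes "n \<ge> 2 * m" "n \<ge> 1"
  shows "fact (n - m) / fact n \<le> 2 ^ m / real n ^ m"
  using assms(1)
proof (induction m)
  case (Suc m)
  then have "m < n" by simp
  then have f: "fact (n - m) = (real n - real m) * fact (n - Suc m)"
    by (metis Suc_diff_Suc fact_Suc of_nat_diff less_imp_le)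
  have "fact (n - Suc m) / fact n = fact (n - m) / fact n * (1 / (real n - real m))"
    using \<open>m < n\<close> f by simp
  also have "\<dots> \<le> (2 ^ m / real n ^ m) * (2 / real n)"
  proof (rule mult_mono)
    show "1 / (real n - real m) \<le> 2 / real n"
      using Suc.prems \<open>m < n\<close> by (simp add: field_simps)
  qed (use Suc \<open>m < n\<close> in auto)
  finally show ?case by (simp add: mult.commute)
qed simp

lemma choose_div_power_limit:
  fixes N :: "nat \<Rightarrow> nat"
  assumes "(\<lambda>n. real (N n) / real n ^ 2) \<longlonglongrightarrow> L"
  shows "(\<lambda>n. real (N n choose j) / real n ^ (2 * j)) \<longlonglongrightarrow> L ^ j / fact j"
proof -
  have inv: "(\<lambda>n. inverse (real n ^ 2)) \<longlonglongrightarrow> 0"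
    by (intro tendsto_inverse_0_at_top filterlim_pow_at_top filterlim_real_sequentially) auto
  have "(\<lambda>n. (\<Prod>i=0..<j. real (N n) / real n ^ 2 - real i * inverse (real n ^ 2)) / fact j)
      \<longlonglongrightarrow> (\<Prod>i=0..<j. L - real i * 0) / fact j"
    by (intro tendsto_intros assms inv) auto
  moreover have "(\<Prod>i=0..<j. real (N n) / real n ^ 2 - real i * inverse (real n ^ 2)) / fact j
      = real (N n choose j) / real n ^ (2 * j)" for n
  proof -
    have "(\<Prod>i=0..<j. real (N n) / real n ^ 2 - real i * inverse (real n ^ 2))
        = (\<Prod>i=0..<j. (real (N n) - real i) / real n ^ 2)"
      by (simp add: left_diff_distrib divide_inverse)
    also have "\<dots> = (\<Prod>i=0..<j. real (N n) - real i) / real n ^ (2 * j)"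
      by (simp add: prod_dividef power_mult)
    also have "(\<Prod>i=0..<j. real (N n) - real i) = fact j * real (N n choose j)"
      by (simp add: binomial_gbinomial gbinomial_prod_rev)
    finally show ?thesis by simp
  qed
  ultimately show ?thesis by simp
qed

text \<open>Without shared lines between different pairs the pairs are disjoint and their union is a
  partial permutation of 2 \<open>card F\<close> points.\<close>

lemma card_perms_through_Union:
  assumes F: "F \<subseteq> close_pairs d n"
    and sep: "\<And>e e'. e \<in> F \<Longrightarrow> e' \<in> F \<Longrightarrow> e' \<noteq> e \<Longrightarrow> \<not> share_line e e'"
  shows "card (perms_through n (\<Union>F)) = fact (n - 2 * card F)"
proof -
  have same: "p = p'" if pp': "p \<in> \<Union>F" "p' \<in> \<Union>F" "fst p = fst p' \<or> snd p = snd p'" for p p'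
  proof -
    obtain e e' where e: "e \<in> F" "p \<in> e" "e' \<in> F" "p' \<in> e'" using pp'(1,2) by blast
    then have "share_line e e'" using pp'(3) unfolding share_line_def by blast
    then have "e' = e" using sep e by blast
    moreover have "partial_perm n e" using e F partial_perm_close_pair by blast
    ultimately show ?thesis using e pp'(3) by (auto simp: partial_perm_def dest: inj_onD)
  qed
  have "\<Union>F \<subseteq> {1..n} \<times> {1..n}" using F close_pairs_subset_grid by blast
  then have "partial_perm n (\<Union>F)"
    unfolding partial_perm_def inj_on_def using same by blast
  moreover have "card (\<Union>F) = 2 * card F"
  proof -
    have "card (\<Union>F) = sum card F"
    proof (rule card_Union_disjoint)
      show "disjoint F"
        using sep unfolding pairwise_def disjnt_def share_line_def by blast
    qed (use F finite_close_pair in blast)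
    also have "\<dots> = (\<Sum>e\<in>F. 2)" using F by (intro sum.cong) (auto intro: card_close_pair)
    finally show ?thesis by simp
  qed
  ultimately show ?thesis using card_perms_through[of n "\<Union>F"] by simp
qed

text \<open>Two points of a graph in a common row or column coincide. Used contrapositively:
  disjoint pairs sharing a line make the contribution of the family vanish.\<close>

lemma perms_through_Union_share_line:
  assumes "F \<subseteq> close_pairs d n" "perms_through n (\<Union>F) \<noteq> {}" "e \<in> F" "e' \<in> F" "share_line e e'"
  shows "e' \<inter> e \<noteq> {}"
proof -
  have "\<Union>F \<subseteq> {1..n} \<times> {1..n}" using assms(1) close_pairs_subset_grid by blast
  moreover obtain \<pi> where "\<pi> \<in> perms_through n (\<Union>F)" using assms(2) by blast
  ultimately have pp: "partial_perm n (\<Union>F)" by (intro perms_through_partial_perm)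
  obtain p p' where p: "p \<in> e" "p' \<in> e'" "fst p = fst p' \<or> snd p = snd p'"
    using assms(5) unfolding share_line_def by blast
  have "p \<in> \<Union>F" "p' \<in> \<Union>F" using p assms by auto
  then have "p = p'" using pp p(3) by (auto simp: partial_perm_def dest: inj_onD)
  then show ?thesis using p by blast
qed

text \<open>The expectation of (X choose j), where X is the number of close pairs in the graph of a
  uniform permutation: (X choose j) counts the j-element families contained in the graph.\<close>

definition binomial_moment :: "nat \<Rightarrow> nat \<Rightarrow> nat \<Rightarrow> real" where
  "binomial_moment d j n = (\<Sum>F\<in>subsets_card (close_pairs d n) j. real (card (perms_through n (\<Union>F))) / fact n)"

text \<open>O(n^2) choices for one pair, only O(n) for a pair sharing a line with it, and O(n^2) for
  each of the others: one power of n is lost against the n^(2j) of all families.\<close>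

lemma card_share_line_subsets_le:
  assumes n: "n \<ge> 1"
  shows "real (card {F \<in> subsets_card (close_pairs d n) j. \<exists>e\<in>F. \<exists>e'\<in>F. e' \<noteq> e \<and> share_line e e'})
    \<le> 4 * ((2 * real d + 3)^2) ^ j * (real n ^ (2 * j) / real n)"
proof (cases "j \<ge> 2")
  case False
  have "{F \<in> subsets_card (close_pairs d n) j. \<exists>e\<in>F. \<exists>e'\<in>F. e' \<noteq> e \<and> share_line e e'} = {}"
  proof (intro equals0I)
    fix F assume "F \<in> {F \<in> subsets_card (close_pairs d n) j. \<exists>e\<in>F. \<exists>e'\<in>F. e' \<noteq> e \<and> share_line e e'}"
    then obtain e e' where e: "{e, e'} \<subseteq> F" "e' \<noteq> e" "F \<subseteq> close_pairs d n" "card F = j" by blast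
    have "finite F" using e(3) finite_close_pairs finite_subset by blast
    then have "card {e, e'} \<le> card F" using e(1) by (rule card_mono)
    then show False using e False by simp
  qed
  then show ?thesis by (simp only: card.empty) simp
next
  case True
  define E where "E = close_pairs d n"
  define K where "K = (2 * real d + 3)^2"
  have E: "real (card E) \<le> real n ^ 2 * K"
  proof -
    have "real (card E) \<le> real (n^2 * (2 * d + 3)^2)"
      unfolding of_nat_le_iff E_def by (rule card_close_pairs_le)
    then show "real (card E) \<le> real n ^ 2 * K" by (simp add: K_def)
  qed
  have K0: "K \<ge> 0" by (simp add: K_def)
  have "real (card {F \<in> subsets_card E j. \<exists>e\<in>F. \<exists>e'\<in>F. e' \<noteq> e \<and> share_line e e'})
      = (\<Sum>F | F \<in> subsets_card E j \<and> (\<exists>e\<in>F. \<exists>e'\<in>F. e' \<noteq> e \<and> share_line e e'). 1)" by simp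
  also have "\<dots> \<le> (\<Sum>e\<in>E. \<Sum>e' | e' \<in> E \<and> e' \<noteq> e \<and> share_line e e'. \<Sum>F\<in>subsets_card E (j - 2). 1)"
    by (rule sum_subsets_card_related_le) (auto simp: E_def)
  also have "\<dots> = (\<Sum>e\<in>E. real (card {e' \<in> E. e' \<noteq> e \<and> share_line e e'}) * real (card (subsets_card E (j - 2))))"
    by simp
  also have "\<dots> \<le> (\<Sum>e\<in>E. (4 * real n * K) * (real n ^ 2 * K) ^ (j - 2))"
  proof (intro sum_mono mult_mono)
    fix e assume e: "e \<in> E"
    have "card {e' \<in> E. e' \<noteq> e \<and> share_line e e'} \<le> card {e' \<in> E. share_line e e'}"
      by (intro card_mono) (auto simp: E_def)
    also have "\<dots> \<le> 4 * n * (2 * d + 3)^2"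
      using e unfolding E_def by (rule card_share_line_le)
    finally have "real (card {e' \<in> E. e' \<noteq> e \<and> share_line e e'}) \<le> real (4 * n * (2 * d + 3)^2)"
      unfolding of_nat_le_iff .
    then show "real (card {e' \<in> E. e' \<noteq> e \<and> share_line e e'}) \<le> 4 * real n * K" by (simp add: K_def)
    have "real (card (subsets_card E (j - 2))) \<le> real (card E ^ (j - 2))"
      unfolding of_nat_le_iff by (rule card_subsets_card_le) (simp add: E_def)
    also have "\<dots> \<le> (real n ^ 2 * K) ^ (j - 2)" using E by (simp add: power_mono)
    finally show "real (card (subsets_card E (j - 2))) \<le> (real n ^ 2 * K) ^ (j - 2)" .
  qed (use K0 in auto)
  also have "\<dots> = real (card E) * ((4 * real n * K) * (real n ^ 2 * K) ^ (j - 2))" by simp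
  also have "\<dots> \<le> (real n ^ 2 * K) * ((4 * real n * K) * (real n ^ 2 * K) ^ (j - 2))"
    using E K0 by (intro mult_right_mono) auto
  also have "\<dots> = 4 * K ^ j * (real n ^ (2 * j) / real n)"
  proof -
    obtain i where "j = i + 2" using True by (metis le_add_diff_inverse add.commute)
    then show ?thesis using n
      by (simp add: power_mult_distrib power_add power_mult power2_eq_square)
  qed
  finally show ?thesis by (simp add: E_def K_def)
qed

text \<open>Replacing every summand by \<open>q n\<close> gives the main term. The error splits
  along \<open>C\<close> (intersecting pairs) inside \<open>B\<close> (shared lines) inside
  \<open>A\<close> (all families): outside \<open>B\<close> the summand equals \<open>q n\<close>,
  on \<open>B - C\<close> it is 0, and on \<open>C\<close> it is bounded by the weighted sum. What
  is left is the sum over \<open>C\<close> and \<open>card B * q n\<close>, both O(1/n).\<close>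

lemma binomial_moment_limit:
  "(\<lambda>n. binomial_moment d j n) \<longlonglongrightarrow> (real d ^ 2 + real d) ^ j / fact j"
proof -
  define E where "E = close_pairs d"
  define K where "K = (2 * real d + 3)^2"
  define q :: "nat \<Rightarrow> real" where "q n = fact (n - 2 * j) / fact n" for n
  define N where "N n F = real (card (perms_through n (\<Union>F))) / fact n" for n F
  define T where "T = 2 * K^2 * ((4 + 2 * real (j - 2)) * K) ^ (j - 2)"
  have lim1: "(\<lambda>n. real n ^ (2 * j) * q n) \<longlonglongrightarrow> 1"
    unfolding q_def by (rule power_times_fact_diff_limit)
  have "(\<lambda>n. real (card (E n) choose j) / real n ^ (2 * j) * (real n ^ (2 * j) * q n))
      \<longlonglongrightarrow> (real d ^ 2 + real d) ^ j / fact j * 1"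
    unfolding E_def by (intro tendsto_mult lim1 choose_div_power_limit card_close_pairs_limit)
  moreover have "\<forall>\<^sub>F n in sequentially.
      real (card (E n) choose j) / real n ^ (2 * j) * (real n ^ (2 * j) * q n) = real (card (E n) choose j) * q n"
    using eventually_gt_at_top[of 0] by eventually_elim simp
  ultimately have main: "(\<lambda>n. real (card (E n) choose j) * q n) \<longlonglongrightarrow> (real d ^ 2 + real d) ^ j / fact j"
    using Lim_transform_eventually by fastforce
  have bound: "\<forall>\<^sub>F n in sequentially. norm (binomial_moment d j n - real (card (E n) choose j) * q n)
      \<le> 4 ^ j * T * (1 / real n) + 4 * K ^ j * (real n ^ (2 * j) * q n) * (1 / real n)"
    \<comment> \<open>A union has up to 2j points, and \<open>fact_diff_div_fact_le\<close> asks for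
      n to be at least twice that.\<close>
    using eventually_ge_at_top[of "4 * j + 1"]
  proof eventually_elim
    case (elim n)
    define A where "A = subsets_card (E n) j"
    define B where "B = {F \<in> A. \<exists>e\<in>F. \<exists>e'\<in>F. e' \<noteq> e \<and> share_line e e'}"
    define C where "C = {F \<in> A. \<exists>e\<in>F. \<exists>e'\<in>F. e' \<noteq> e \<and> e' \<inter> e \<noteq> {}}"
    have n: "n \<ge> 1" using elim by simp
    have finA: "finite A" by (rule finite_subset[of _ "Pow (E n)"]) (auto simp: A_def E_def)
    have q0: "q n \<ge> 0" by (simp add: q_def)
    have N0: "N n F \<ge> 0" for F by (simp add: N_def)
    have CB: "C \<subseteq> B" unfolding B_def C_def share_line_def by blast
    have good: "N n F = q n" if "F \<in> A - B" for F
    proof -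
      have "F \<subseteq> close_pairs d n" "card F = j" using that by (auto simp: A_def E_def)
      moreover have "\<not> share_line e e'" if "e \<in> F" "e' \<in> F" "e' \<noteq> e" for e e'
        using that \<open>F \<in> A - B\<close> unfolding B_def by blast
      ultimately show ?thesis using card_perms_through_Union[of F d n] by (simp add: N_def q_def)
    qed
    have zero: "N n F = 0" if F: "F \<in> B - C" for F
    proof -
      have "F \<subseteq> close_pairs d n" using F by (auto simp: B_def A_def E_def)
      moreover obtain e e' where e: "e \<in> F" "e' \<in> F" "e' \<noteq> e" "share_line e e'"
        using F unfolding B_def by blast
      moreover have "e' \<inter> e = {}"
      proof (rule ccontr)
        assume "e' \<inter> e \<noteq> {}"
        then have "\<exists>e\<in>F. \<exists>e'\<in>F. e' \<noteq> e \<and> e' \<inter> e \<noteq> {}" using e by blast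
        then show False using F unfolding B_def C_def by simp blast
      qed
      ultimately have "perms_through n (\<Union>F) = {}"
        using perms_through_Union_share_line[of F d n e e'] by auto
      then show ?thesis by (simp add: N_def)
    qed
    have NC: "N n F \<le> 4 ^ j * (1 / real n ^ card (\<Union>F))" if "F \<in> C" for F
    proof -
      have F: "F \<subseteq> close_pairs d n" "card F = j" using that by (auto simp: C_def A_def E_def)
      then have sub: "\<Union>F \<subseteq> {1..n} \<times> {1..n}" using close_pairs_subset_grid by blast
      have c: "card (\<Union>F) \<le> 2 * j" using card_Union_close_pairs_le[OF F(1)] F by simp
      have "real (card (perms_through n (\<Union>F))) \<le> real (fact (n - card (\<Union>F)))"
        unfolding of_nat_le_iff by (rule card_perms_through_le[OF sub])
      then have "N n F \<le> fact (n - card (\<Union>F)) / fact n"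
        unfolding N_def by (intro divide_right_mono) auto
      also have "\<dots> \<le> 2 ^ card (\<Union>F) / real n ^ card (\<Union>F)"
        using c elim by (intro fact_diff_div_fact_le) auto
      also have "\<dots> \<le> 2 ^ (2 * j) / real n ^ card (\<Union>F)"
        using c by (intro divide_right_mono power_increasing) auto
      finally show ?thesis by (simp add: power_mult)
    qed
    have "binomial_moment d j n - real (card (E n) choose j) * q n = (\<Sum>F\<in>A. N n F - q n)"
      using n_subsets[of "E n" j]
      by (simp add: binomial_moment_def A_def N_def E_def sum_subtractf)
    also have "\<dots> = (\<Sum>F\<in>B. N n F - q n)"
      using good finA by (intro sum.mono_neutral_right) (auto simp: B_def)
    finally have "norm (binomial_moment d j n - real (card (E n) choose j) * q n) \<le> (\<Sum>F\<in>B. norm (N n F - q n))"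
      by (simp only: sum_norm_le[of B, OF order_refl])
    also have "\<dots> \<le> (\<Sum>F\<in>B. N n F + q n)"
      using q0 N0 by (intro sum_mono) (simp add: abs_le_iff add_increasing)
    also have "\<dots> = (\<Sum>F\<in>B. N n F) + real (card B) * q n" by (simp add: sum.distrib)
    also have "(\<Sum>F\<in>B. N n F) = (\<Sum>F\<in>C. N n F)"
      using zero CB finA by (intro sum.mono_neutral_right) (auto simp: B_def)
    also have "\<dots> \<le> (\<Sum>F\<in>C. 4 ^ j * (1 / real n ^ card (\<Union>F)))" by (intro sum_mono NC)
    also have "\<dots> = 4 ^ j * (\<Sum>F\<in>C. 1 / real n ^ card (\<Union>F))" by (simp add: sum_distrib_left)
    also have "\<dots> \<le> 4 ^ j * (T / real n)"
      using sum_intersecting_weight_le[OF n, of d j]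
      by (intro mult_left_mono) (simp_all add: C_def A_def E_def T_def K_def)
    also have "real (card B) * q n \<le> (4 * K ^ j * (real n ^ (2 * j) / real n)) * q n"
      using card_share_line_subsets_le[OF n, of d j] q0
      by (intro mult_right_mono) (simp_all add: B_def A_def E_def K_def)
    finally show ?case by (simp add: mult_ac)
  qed
  have "(\<lambda>n. 4 ^ j * T * (1 / real n) + 4 * K ^ j * (real n ^ (2 * j) * q n) * (1 / real n))
      \<longlonglongrightarrow> 4 ^ j * T * 0 + 4 * K ^ j * 1 * 0"
    by (intro tendsto_intros lim_1_over_n lim1)
  then have "(\<lambda>n. 4 ^ j * T * (1 / real n) + 4 * K ^ j * (real n ^ (2 * j) * q n) * (1 / real n)) \<longlonglongrightarrow> 0"
    by simp
  from Lim_null_comparison[OF bound this]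
  have "(\<lambda>n. binomial_moment d j n - real (card (E n) choose j) * q n) \<longlonglongrightarrow> 0" .
  from tendsto_add[OF this main] show ?thesis by simp
qed

subsection \<open>Poisson limit\<close>

lemma sum_choose_eq_binomial_moment:
  "(\<Sum>\<pi> | \<pi> permutes {1..n}. real (card {e \<in> close_pairs d n. \<pi> \<in> perms_through n e} choose j)) / fact n
     = binomial_moment d j n"
proof -
  define S where "S = {\<pi>. \<pi> permutes {1..n::nat}}"
  define A where "A = subsets_card (close_pairs d n) j"
  have fS: "finite S" unfolding S_def by (rule finite_permutations) simp
  have fA: "finite A" by (rule finite_subset[of _ "Pow (close_pairs d n)"]) (auto simp: A_def)
  have "(\<Sum>\<pi>\<in>S. real (card {e \<in> close_pairs d n. \<pi> \<in> perms_through n e} choose j))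
      = (\<Sum>\<pi>\<in>S. \<Sum>F\<in>A. of_bool (\<pi> \<in> perms_through n (\<Union>F)))"
  proof (rule sum.cong)
    fix \<pi> assume \<pi>: "\<pi> \<in> S"
    have "{F. F \<subseteq> {e \<in> close_pairs d n. \<pi> \<in> perms_through n e} \<and> card F = j}
        = {F \<in> A. \<pi> \<in> perms_through n (\<Union>F)}"
      using \<pi> unfolding A_def S_def perms_through_def by auto
    then have "card {e \<in> close_pairs d n. \<pi> \<in> perms_through n e} choose j
        = card {F \<in> A. \<pi> \<in> perms_through n (\<Union>F)}"
      using n_subsets[of "{e \<in> close_pairs d n. \<pi> \<in> perms_through n e}" j] by simp
    then show "real (card {e \<in> close_pairs d n. \<pi> \<in> perms_through n e} choose j)
        = (\<Sum>F\<in>A. of_bool (\<pi> \<in> perms_through n (\<Union>F)))"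
      using fA by (simp add: of_bool_def sum.If_cases Int_def)
  qed simp
  also have "\<dots> = (\<Sum>F\<in>A. \<Sum>\<pi>\<in>S. of_bool (\<pi> \<in> perms_through n (\<Union>F)))" by (rule sum.swap)
  also have "\<dots> = (\<Sum>F\<in>A. real (card (perms_through n (\<Union>F))))"
  proof (rule sum.cong)
    fix F
    have "S \<inter> {\<pi>. \<pi> \<in> perms_through n (\<Union>F)} = perms_through n (\<Union>F)"
      by (auto simp: S_def perms_through_def)
    then show "(\<Sum>\<pi>\<in>S. of_bool (\<pi> \<in> perms_through n (\<Union>F))) = real (card (perms_through n (\<Union>F)))"
      using fS by (simp add: of_bool_def sum.If_cases)
  qed simp
  finally show ?thesis
    unfolding binomial_moment_def A_def S_def by (simp add: sum_divide_distrib)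
qed

text \<open>For positive x the truncated alternating sum is exactly (-1)^m times (x - 1 choose m).
  The two-sided error, bounded by the last term included, turns into a binomial moment after
  averaging.\<close>

lemma bonferroni_choose:
  "\<bar>of_bool (x = 0) - (\<Sum>j\<le>m. (-1) ^ j * real (x choose j))\<bar> \<le> real (x choose m)"
proof (cases "x = 0")
  case True
  have "(\<Sum>j\<le>m. (-1) ^ j * real (0 choose j)) = (\<Sum>j\<in>{0}. (-1) ^ j * real (0 choose j))"
    by (intro sum.mono_neutral_right) auto
  then show ?thesis using True by simp
next
  case False
  then obtain y where y: "x = Suc y" by (cases x) auto
  have "(\<Sum>j\<le>m. (-1) ^ j * real (x choose j)) = (-1) ^ m * real (y choose m)"
    using gbinomial_sum_lower_neg[of "real x" m] y by (simp add: binomial_gbinomial mult.commute)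
  moreover have "y choose m \<le> x choose m" using y by (intro binomial_right_mono) simp
  ultimately show ?thesis using False by (simp add: abs_mult)
qed

definition dist_tail :: "nat \<Rightarrow> nat \<Rightarrow> real" where
  "dist_tail n k = real (card {\<pi>. \<pi> permutes {1..n} \<and> k \<le> perm_dist n \<pi>}) / fact n"

lemma dist_tail_bonferroni:
  assumes n: "n \<ge> 2"
  shows "\<bar>dist_tail n (d + 2) - (\<Sum>j\<le>m. (-1) ^ j * binomial_moment d j n)\<bar> \<le> binomial_moment d m n"
proof -
  define S where "S = {\<pi>. \<pi> permutes {1..n::nat}}"
  define X where "X \<pi> = card {e \<in> close_pairs d n. \<pi> \<in> perms_through n e}" for \<pi>
  have fS: "finite S" unfolding S_def by (rule finite_permutations) simp
  have "{\<pi>. \<pi> permutes {1..n} \<and> d + 2 \<le> perm_dist n \<pi>} = S \<inter> {\<pi>. X \<pi> = 0}"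
    using perm_dist_ge_iff[OF n, of _ d] by (auto simp: S_def X_def)
  then have "dist_tail n (d + 2) = (\<Sum>\<pi>\<in>S. of_bool (X \<pi> = 0)) / fact n"
    using fS by (simp add: dist_tail_def of_bool_def sum.If_cases)
  moreover have fm: "binomial_moment d j n = (\<Sum>\<pi>\<in>S. real (X \<pi> choose j)) / fact n" for j
    unfolding S_def X_def by (rule sum_choose_eq_binomial_moment[symmetric])
  moreover have "(\<Sum>j\<le>m. (-1) ^ j * binomial_moment d j n)
      = (\<Sum>\<pi>\<in>S. \<Sum>j\<le>m. (-1) ^ j * real (X \<pi> choose j)) / fact n"
    unfolding fm by (subst sum.swap) (simp add: sum_divide_distrib sum_distrib_left)
  ultimately have "dist_tail n (d + 2) - (\<Sum>j\<le>m. (-1) ^ j * binomial_moment d j n)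
      = (\<Sum>\<pi>\<in>S. of_bool (X \<pi> = 0) - (\<Sum>j\<le>m. (-1) ^ j * real (X \<pi> choose j))) / fact n"
    by (simp add: sum_subtractf diff_divide_distrib)
  also have "\<bar>\<dots>\<bar> = \<bar>\<Sum>\<pi>\<in>S. of_bool (X \<pi> = 0) - (\<Sum>j\<le>m. (-1) ^ j * real (X \<pi> choose j))\<bar> / fact n"
    by (simp only: abs_divide) simp
  also have "\<dots> \<le> (\<Sum>\<pi>\<in>S. real (X \<pi> choose m)) / fact n"
    by (intro divide_right_mono order_trans[OF sum_abs] sum_mono bonferroni_choose) simp
  also have "\<dots> = binomial_moment d m n" by (simp add: fm)
  finally show ?thesis .
qed

text \<open>The truncation m is fixed first, making both the exponential series and the limiting
  error L^m / m! accurate to \<epsilon>/4; only then does n grow. Three errors below \<epsilon>/4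
  add up.\<close>

lemma dist_tail_limit:
  "(\<lambda>n. dist_tail n (d + 2)) \<longlonglongrightarrow> exp (- (real d ^ 2) - real d)"
proof -
  define L where "L = real d ^ 2 + real d"
  define s where "s m = (\<Sum>j\<le>m. (-1) ^ j * (L ^ j / fact j))" for m
  have "(\<lambda>j. (- L) ^ j /\<^sub>R fact j) sums exp (- L)" by (rule exp_converges)
  moreover have "(- L) ^ j /\<^sub>R fact j = (-1) ^ j * (L ^ j / fact j)" for j
    by (simp add: power_minus[of L] divide_inverse mult_ac)
  ultimately have "(\<lambda>j. (-1) ^ j * (L ^ j / fact j)) sums exp (- L)" by simp
  then have s: "s \<longlonglongrightarrow> exp (- L)" unfolding s_def sums_def_le .
  have p: "(\<lambda>m. L ^ m / fact m) \<longlonglongrightarrow> 0"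
    using summable_LIMSEQ_zero[OF summable_exp[of L]] by (simp add: divide_inverse mult.commute)
  have "(\<lambda>n. dist_tail n (d + 2)) \<longlonglongrightarrow> exp (- L)"
  proof (rule tendstoI)
    fix \<epsilon> :: real assume \<epsilon>: "\<epsilon> > 0"
    have "\<forall>\<^sub>F m in sequentially. dist (s m) (exp (- L)) < \<epsilon> / 4 \<and> L ^ m / fact m < \<epsilon> / 4"
      using \<epsilon> by (intro eventually_conj tendstoD[OF s] order_tendstoD(2)[OF p]) auto
    then obtain m where m: "dist (s m) (exp (- L)) < \<epsilon> / 4" "L ^ m / fact m < \<epsilon> / 4"
      using eventually_happens[of _ sequentially] by auto
    have "(\<lambda>n. \<Sum>j\<le>m. (-1) ^ j * binomial_moment d j n) \<longlonglongrightarrow> s m"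
      unfolding s_def L_def by (intro tendsto_intros binomial_moment_limit)
    then have "\<forall>\<^sub>F n in sequentially. dist (\<Sum>j\<le>m. (-1) ^ j * binomial_moment d j n) (s m) < \<epsilon> / 4"
      using \<epsilon> by (intro tendstoD) auto
    moreover have "\<forall>\<^sub>F n in sequentially. binomial_moment d m n < \<epsilon> / 4"
      using binomial_moment_limit[of d m] m(2) unfolding L_def by (rule order_tendstoD(2))
    ultimately show "\<forall>\<^sub>F n in sequentially. dist (dist_tail n (d + 2)) (exp (- L)) < \<epsilon>"
      using eventually_ge_at_top[of 2]
    proof eventually_elim
      case (elim n)
      then show ?case using dist_tail_bonferroni[of n d m] m(1) \<epsilon> unfolding dist_real_def by linarith
    qed
  qed
  then show ?thesis by (simp add: L_def)
qed

subsection \<open>Exponential tail bound\<close>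

text \<open>Cut the values into blocks of length d + 1; two values in one block differ by at most d.
  At least n/2 values fall into at most 2n/(d + 1) blocks, and convexity bounds below the number of
  ordered pairs within blocks.\<close>

lemma card_near_pairs_ge:
  fixes R :: "nat set"
  assumes R: "R \<subseteq> {1..n}" and half: "n \<le> 2 * card R" and D: "16 \<le> d + 1" "d + 1 \<le> n"
  shows "real n * (real d + 1) / 16
    \<le> real (card {(u,v). u \<in> R \<and> v \<in> R \<and> u \<noteq> v \<and> nat \<bar>int u - int v\<bar> \<le> d})"
proof -
  define D where "D = d + 1"
  have D16: "16 \<le> D" "D \<le> n" using assms by (auto simp: D_def)
  have fR: "finite R" using R finite_subset by blast
  define C where "C = {(u,v). u \<in> R \<and> v \<in> R \<and> u \<noteq> v \<and> nat \<bar>int u - int v\<bar> \<le> d}"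
  define A where "A = (SIGMA u:R. {v \<in> R. v div D = u div D} - {u})"
  define x where "x b = real (card {v \<in> R. v div D = b})" for b
  \<comment> \<open>The tangent of x(x - 1) at \<open>c\<close> replaces Cauchy-Schwarz. The mean
    block occupancy is at least D/4, and half of that is taken; the surplus is then n(D - 16)/32,
    where the hypothesis 16 \<le> d + 1 enters.\<close>
  define c where "c = real D / 8"
  have fC: "finite C" by (rule finite_subset[of _ "R \<times> R"]) (use fR in \<open>auto simp: C_def\<close>)
  have "A \<subseteq> C"
  proof
    fix p assume p: "p \<in> A"
    obtain u v where uv: "p = (u,v)" by (cases p)
    with p have "u \<in> R" "v \<in> R" "u \<noteq> v" "v div D = u div D" by (auto simp: A_def)
    moreover have "nat \<bar>int u - int v\<bar> \<le> d"
    proof -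
      have "u = D * (u div D) + u mod D" "v = D * (u div D) + v mod D"
        using calculation by (metis mult_div_mod_eq)+
      moreover have "u mod D < D" "v mod D < D" using D16 by auto
      ultimately show ?thesis unfolding D_def by linarith
    qed
    ultimately show "p \<in> C" using uv by (simp add: C_def)
  qed
  have "real n * real D / 16 \<le> (real D / 4 - 1) * (real n / 2) - c^2 * (2 * real n / real D)"
  proof -
    have "(real D / 4 - 1) * (real n / 2) - c^2 * (2 * real n / real D) - real n * real D / 16
        = real n * (real D - 16) / 32"
      using D16 by (simp add: c_def field_simps power2_eq_square)
    also have "\<dots> \<ge> 0" using D16 by simp
    finally show ?thesis by simp
  qed
  also have "\<dots> \<le> (2 * c - 1) * real (card R) - c^2 * real (n div D + 1)"
  proof (intro diff_mono mult_mono)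
    have "real (n div D * D) \<le> real n" unfolding of_nat_le_iff by simp
    then have "real (n div D) \<le> real n / real D" using D16 by (simp add: field_simps)
    moreover have "1 \<le> real n / real D" using D16 by simp
    ultimately show "real (n div D + 1) \<le> 2 * real n / real D" by simp
  qed (use half D16 in \<open>auto simp: c_def\<close>)
  also have "\<dots> = (\<Sum>b\<in>{..n div D}. (2 * c - 1) * x b - c^2)"
  proof -
    have "(\<Sum>b\<in>{..n div D}. x b) = (\<Sum>b\<in>{..n div D}. \<Sum>v | v \<in> R \<and> v div D = b. 1)"
      by (simp add: x_def)
    also have "\<dots> = (\<Sum>v\<in>R. 1)"
      by (rule sum.group) (use fR R in \<open>auto intro!: div_le_mono\<close>)
    finally have "(\<Sum>b\<in>{..n div D}. x b) = real (card R)" by simp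
    then show ?thesis by (simp add: sum_subtractf sum_distrib_left[symmetric])
  qed
  also have "\<dots> \<le> (\<Sum>b\<in>{..n div D}. x b * (x b - 1))"
  proof (rule sum_mono)
    fix b
    have "0 \<le> (x b - c)^2" by simp
    then show "(2 * c - 1) * x b - c^2 \<le> x b * (x b - 1)" by (simp add: power2_eq_square algebra_simps)
  qed
  also have "\<dots> = (\<Sum>b\<in>{..n div D}. \<Sum>u | u \<in> R \<and> u div D = b. x (u div D) - 1)"
    by (intro sum.cong) (auto simp: x_def)
  also have "\<dots> = (\<Sum>u\<in>R. x (u div D) - 1)"
    by (rule sum.group) (use fR R in \<open>auto intro!: div_le_mono\<close>)
  also have "\<dots> = (\<Sum>u\<in>R. real (card ({v \<in> R. v div D = u div D} - {u})))"
  proof (rule sum.cong)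
    fix u assume u: "u \<in> R"
    have "card {v \<in> R. v div D = u div D} > 0" using u fR by (auto simp: card_gt_0_iff)
    then show "x (u div D) - 1 = real (card ({v \<in> R. v div D = u div D} - {u}))"
      using u fR by (simp add: x_def of_nat_diff)
  qed simp
  also have "\<dots> = real (card A)" unfolding A_def using fR by (subst card_SigmaI) auto
  also have "\<dots> \<le> real (card C)" using \<open>A \<subseteq> C\<close> fC by (simp add: card_mono)
  finally show ?thesis by (simp add: C_def D_def add.commute)
qed

text \<open>The position pairs (1,2), (3,4), ... are disjoint, so they can be exposed one after the
  other; the condition is a consequence of \<open>perm_dist n\<close> being at least d + 2.\<close>

definition spread_perms :: "nat \<Rightarrow> nat \<Rightarrow> nat \<Rightarrow> (nat \<Rightarrow> nat) set" where
  "spread_perms d n t = {\<pi>. \<pi> permutes {1..n} \<and>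
     (\<forall>s<t. nat \<bar>int (\<pi> (2 * s + 1)) - int (\<pi> (2 * s + 2))\<bar> > d)}"

text \<open>Given the first 2t values, the next two form a uniformly random ordered pair of unused values.\<close>

lemma card_near_extensions_ge:
  assumes V: "partial_perm n V" and fV: "fst ` V = {1..2 * t}" and t: "4 * (t + 1) \<le> n"
    and D: "16 \<le> d + 1" "d + 1 \<le> n"
  shows "(real d + 1) / (16 * real n) * real (card (perms_through n V))
    \<le> real (card {\<pi> \<in> perms_through n V. nat \<bar>int (\<pi> (2 * t + 1)) - int (\<pi> (2 * t + 2))\<bar> \<le> d})"
proof -
  define R where "R = {1..n} - snd ` V"
  define C where "C = {(u,v). u \<in> R \<and> v \<in> R \<and> u \<noteq> v \<and> nat \<bar>int u - int v\<bar> \<le> d}"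
  define W where "W = (\<lambda>(u,v). insert (2 * t + 1, u) (insert (2 * t + 2, v) V))"
  have fin: "finite V" using V by (rule partial_perm_finite)
  have cV: "card V = 2 * t"
  proof -
    have "card (fst ` V) = card V" using V by (auto simp: partial_perm_def card_image)
    then show ?thesis using fV by simp
  qed
  have cR: "card R = n - 2 * t"
  proof -
    have "card (snd ` V) = card V" using V by (auto simp: partial_perm_def card_image)
    moreover have "snd ` V \<subseteq> {1..n}" using V by (auto simp: partial_perm_def)
    ultimately show ?thesis unfolding R_def by (simp add: card_Diff_subset finite_subset cV)
  qed
  have fC: "finite C" by (rule finite_subset[of _ "R \<times> R"]) (auto simp: C_def R_def)
  have out: "2 * t + 1 \<notin> fst ` V" "2 * t + 2 \<notin> fst ` V" unfolding fV by auto
  have cW: "card (perms_through n (W p)) = fact (n - 2 * t - 2)" if "p \<in> C" for p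
  proof -
    obtain u v where p: "p = (u,v)" by (cases p)
    have uv: "u \<in> {1..n}" "v \<in> {1..n}" "u \<notin> snd ` V" "v \<notin> snd ` V" "u \<noteq> v"
      using that by (auto simp: p C_def R_def)
    have "partial_perm n (W p)"
      using V uv out t unfolding partial_perm_def W_def p
      by (auto simp: inj_on_insert)
    moreover have "card (W p) = 2 * t + 2"
    proof -
      have "(2 * t + 1, u) \<notin> V" "(2 * t + 2, v) \<notin> V" using out by force+
      then show ?thesis using fin by (simp add: W_def p cV)
    qed
    ultimately show ?thesis using card_perms_through[of n "W p"] by simp
  qed
  have "real (fact (n - 2 * t)) \<le> real n ^ 2 * fact (n - 2 * t - 2)"
  proof -
    define k where "k = n - 2 * t - 2"
    have k: "n - 2 * t = Suc (Suc k)" using t by (simp add: k_def)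
    have "real (Suc (Suc k)) * real (Suc k) \<le> real n * real n"
      using k by (intro mult_mono) auto
    then have "real (Suc (Suc k)) * real (Suc k) * fact k \<le> real n * real n * fact k"
      by (rule mult_right_mono) simp
    moreover have "n - 2 * t - 2 = k" by (simp add: k_def)
    moreover have "real (fact (n - 2 * t)) = real (Suc (Suc k)) * real (Suc k) * fact k"
      unfolding k by (simp add: algebra_simps)
    ultimately show ?thesis by (simp only: power2_eq_square)
  qed
  then have "(real d + 1) / (16 * real n) * real (card (perms_through n V))
     \<le> (real d + 1) / (16 * real n) * (real n ^ 2 * fact (n - 2 * t - 2))"
    using card_perms_through[OF V] cV by (intro mult_left_mono) auto
  also have "\<dots> = real n * (real d + 1) / 16 * fact (n - 2 * t - 2)"
    using D by (simp add: power2_eq_square)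
  \<comment> \<open>From \<open>4 * (t + 1) \<le> n\<close>, at least half of the values are still
    available, as \<open>card_near_pairs_ge\<close> demands.\<close>
  also have "\<dots> \<le> real (card C) * fact (n - 2 * t - 2)"
    unfolding C_def
    by (intro mult_right_mono card_near_pairs_ge) (use cR t D in \<open>auto simp: R_def\<close>)
  also have "\<dots> = real (\<Sum>p\<in>C. card (perms_through n (W p)))" using cW by simp
  also have "\<dots> = real (card (\<Union>p\<in>C. perms_through n (W p)))"
  proof (subst card_UN_disjoint)
    show "\<forall>p\<in>C. \<forall>p'\<in>C. p \<noteq> p' \<longrightarrow> perms_through n (W p) \<inter> perms_through n (W p') = {}"
      by (auto simp: W_def perms_through_def)
  qed (use fC in auto)
  also have "\<dots> \<le> real (card {\<pi> \<in> perms_through n V. nat \<bar>int (\<pi> (2 * t + 1)) - int (\<pi> (2 * t + 2))\<bar> \<le> d})"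
  proof -
    have "(\<Union>p\<in>C. perms_through n (W p))
        \<subseteq> {\<pi> \<in> perms_through n V. nat \<bar>int (\<pi> (2 * t + 1)) - int (\<pi> (2 * t + 2))\<bar> \<le> d}"
      by (auto simp: W_def C_def perms_through_def)
    then show ?thesis by (simp add: card_mono)
  qed
  finally show ?thesis .
qed

text \<open>Conditioning on the first 2t values, encoded by the partial graph
  \<open>G \<pi>\<close>: these classes partition \<open>spread_perms d n t\<close>, and in each the
  next pair is near with conditional probability at least (d + 1) / (16 n).\<close>

lemma card_spread_perms_Suc_le:
  assumes t: "4 * (t + 1) \<le> n" and D: "16 \<le> d + 1" "d + 1 \<le> n"
  shows "real (card (spread_perms d n (Suc t)))
    \<le> (1 - (real d + 1) / (16 * real n)) * real (card (spread_perms d n t))"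
proof -
  define B where "B = spread_perms d n t"
  define q where "q = (real d + 1) / (16 * real n)"
  define G where "G \<pi> = (\<lambda>i. (i, \<pi> i)) ` {1..2 * t}" for \<pi> :: "nat \<Rightarrow> nat"
  define far where "far \<pi> \<longleftrightarrow> nat \<bar>int (\<pi> (2 * t + 1)) - int (\<pi> (2 * t + 2))\<bar> > d" for \<pi> :: "nat \<Rightarrow> nat"
  have fB: "finite B"
    by (rule finite_subset[of _ "{\<pi>. \<pi> permutes {1..n}}"])
       (auto simp: B_def spread_perms_def finite_permutations)
  have same: "\<pi> i = \<sigma> i" if "\<pi> \<in> perms_through n (G \<sigma>)" "i \<in> {1..2 * t}" for \<pi> \<sigma> i
    using that by (auto simp: perms_through_def G_def)
  \<comment> \<open>Membership in \<open>B\<close> depends only on the first 2t values, so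
    \<open>B\<close> is a union of full classes and distinct classes are disjoint.\<close>
  have mem: "\<pi> \<in> B \<and> G \<pi> = G \<sigma>" if "\<sigma> \<in> B" "\<pi> \<in> perms_through n (G \<sigma>)" for \<pi> \<sigma>
  proof -
    have eq: "\<pi> i = \<sigma> i" if "i \<in> {1..2 * t}" for i using same[OF \<open>\<pi> \<in> _\<close> that] .
    then have "G \<pi> = G \<sigma>" by (auto simp: G_def)
    moreover have "\<pi> (2 * s + 1) = \<sigma> (2 * s + 1)" "\<pi> (2 * s + 2) = \<sigma> (2 * s + 2)" if "s < t" for s
      using that by (auto intro!: eq)
    ultimately show ?thesis
      using that by (auto simp: B_def spread_perms_def perms_through_def)
  qed
  have self: "\<pi> \<in> perms_through n (G \<pi>)" if "\<pi> \<in> B" for \<pi>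
    using that by (auto simp: B_def spread_perms_def perms_through_def G_def)
  have Beq: "B = (\<Union>V\<in>G ` B. perms_through n V)" using mem self by blast
  have disj: "\<forall>V\<in>G ` B. \<forall>V'\<in>G ` B. V \<noteq> V' \<longrightarrow> perms_through n V \<inter> perms_through n V' = {}"
    using mem by blast
  have step: "real (card {\<pi> \<in> perms_through n V. far \<pi>}) \<le> (1 - q) * real (card (perms_through n V))"
    if VB: "V \<in> G ` B" for V
  proof -
    obtain \<sigma> where \<sigma>: "\<sigma> \<in> B" "V = G \<sigma>" using VB by blast
    have perm: "\<sigma> permutes {1..n}" using \<sigma> by (simp add: B_def spread_perms_def)
    have "(i, \<sigma> i) \<in> {1..n} \<times> {1..n}" if "i \<in> {1..2 * t}" for i
      using that t permutes_in_image[OF perm, of i] by simp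
    then have "V \<subseteq> {1..n} \<times> {1..n}" unfolding \<sigma>(2) G_def by blast
    then have V: "partial_perm n V" using self[OF \<sigma>(1)] by (intro perms_through_partial_perm) (simp_all add: \<sigma>(2))
    have fV: "fst ` V = {1..2 * t}" by (force simp: \<sigma> G_def)
    have "{\<pi> \<in> perms_through n V. far \<pi>}
        = perms_through n V - {\<pi> \<in> perms_through n V. nat \<bar>int (\<pi> (2 * t + 1)) - int (\<pi> (2 * t + 2))\<bar> \<le> d}"
      by (auto simp: far_def)
    then have "real (card {\<pi> \<in> perms_through n V. far \<pi>}) = real (card (perms_through n V))
        - real (card {\<pi> \<in> perms_through n V. nat \<bar>int (\<pi> (2 * t + 1)) - int (\<pi> (2 * t + 2))\<bar> \<le> d})"
      by (simp add: card_Diff_subset of_nat_diff card_mono)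
    also have "\<dots> \<le> real (card (perms_through n V)) - q * real (card (perms_through n V))"
      using card_near_extensions_ge[OF V fV t D] unfolding q_def by (rule diff_left_mono)
    finally show ?thesis by (simp add: left_diff_distrib)
  qed
  have "spread_perms d n (Suc t) = {\<pi> \<in> B. far \<pi>}"
    by (auto simp: spread_perms_def B_def far_def less_Suc_eq)
  also have "\<dots> = (\<Union>V\<in>G ` B. {\<pi> \<in> perms_through n V. far \<pi>})" using Beq by blast
  finally have "card (spread_perms d n (Suc t)) \<le> (\<Sum>V\<in>G ` B. card {\<pi> \<in> perms_through n V. far \<pi>})"
    by (simp only: card_UN_le finite_imageI fB)
  then have "real (card (spread_perms d n (Suc t)))
      \<le> (\<Sum>V\<in>G ` B. real (card {\<pi> \<in> perms_through n V. far \<pi>}))"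
    by (simp only: of_nat_le_iff flip: of_nat_sum)
  also have "\<dots> \<le> (\<Sum>V\<in>G ` B. (1 - q) * real (card (perms_through n V)))" by (intro sum_mono step)
  also have "\<dots> = (1 - q) * real (\<Sum>V\<in>G ` B. card (perms_through n V))" by (simp add: sum_distrib_left)
  also have "(\<Sum>V\<in>G ` B. card (perms_through n V)) = card (\<Union>V\<in>G ` B. perms_through n V)"
    using fB disj by (intro card_UN_disjoint[symmetric]) auto
  also have "\<dots> = card B" by (simp only: Beq[symmetric])
  finally show ?thesis by (simp add: B_def q_def)
qed

lemma perm_dist_le:
  assumes \<pi>: "\<pi> permutes {1..n}" and ij: "i \<in> {1..n}" "j \<in> {1..n}" "i < j"
  shows "perm_dist n \<pi> \<le> nat \<bar>int i - int j\<bar> + nat \<bar>int (\<pi> i) - int (\<pi> j)\<bar>"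
proof -
  define c where "c i j = nat \<bar>int i - int j\<bar> + nat \<bar>int (\<pi> i) - int (\<pi> j)\<bar>" for i j
  define S where "S = {c i j | i j. i \<in> {1..n} \<and> j \<in> {1..n} \<and> i < j}"
  have "S \<subseteq> (\<lambda>(i,j). c i j) ` ({1..n} \<times> {1..n})" by (auto simp: S_def)
  then have "finite S" by (rule finite_subset) auto
  moreover have "c i j \<in> S" using ij unfolding S_def by blast
  ultimately have "Min S \<le> c i j" by (rule Min_le)
  then show ?thesis by (simp add: perm_dist_def S_def c_def)
qed

lemma dist_tail_le_1: "dist_tail n k \<le> 1"
proof -
  have "card {\<pi>. \<pi> permutes {1..n} \<and> k \<le> perm_dist n \<pi>} \<le> card {\<pi>. \<pi> permutes {1..n}}"
    by (intro card_mono) (auto simp: finite_permutations)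
  also have "\<dots> = fact n" using card_permutations[of "{1..n}" n] by simp
  finally have "real (card {\<pi>. \<pi> permutes {1..n} \<and> k \<le> perm_dist n \<pi>}) \<le> real (fact n)"
    unfolding of_nat_le_iff .
  then show ?thesis by (simp add: dist_tail_def)
qed

text \<open>Adjacent positions contribute 1 to the distance, so distance at least d + 2 forces their
  values to differ by more than d. Applying the one-step bound \<open>n div 4\<close> times and 1 -
  q \<le> exp (-q) gives the decay.\<close>

lemma dist_tail_exp_bound:
  assumes D: "16 \<le> d + 1" "d + 1 \<le> n"
  shows "dist_tail n (d + 2) \<le> exp (- (real d + 1) / 128)"
proof -
  define q where "q = (real d + 1) / (16 * real n)"
  define T where "T = n div 4"
  have q: "0 \<le> q" "q \<le> 1" using D by (auto simp: q_def field_simps)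
  have "real (card (spread_perms d n t)) \<le> (1 - q) ^ t * fact n" if "t \<le> T" for t
    using that
  proof (induction t)
    case 0
    then show ?case using card_permutations[of "{1..n}" n] by (simp add: spread_perms_def)
  next
    case (Suc t)
    have "real (card (spread_perms d n (Suc t))) \<le> (1 - q) * real (card (spread_perms d n t))"
      unfolding q_def using Suc.prems D by (intro card_spread_perms_Suc_le) (auto simp: T_def)
    also have "\<dots> \<le> (1 - q) * ((1 - q) ^ t * fact n)" using Suc q by (intro mult_left_mono) auto
    finally show ?case by simp
  qed
  from this[of T] have spread: "real (card (spread_perms d n T)) \<le> (1 - q) ^ T * fact n" by simp
  have "{\<pi>. \<pi> permutes {1..n} \<and> d + 2 \<le> perm_dist n \<pi>} \<subseteq> spread_perms d n T"
  proof
    fix \<pi> assume "\<pi> \<in> {\<pi>. \<pi> permutes {1..n} \<and> d + 2 \<le> perm_dist n \<pi>}"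
    then have \<pi>: "\<pi> permutes {1..n}" "d + 2 \<le> perm_dist n \<pi>" by auto
    have "nat \<bar>int (\<pi> (2 * s + 1)) - int (\<pi> (2 * s + 2))\<bar> > d" if "s < T" for s
    proof -
      have "2 * s + 2 \<le> n" using that by (auto simp: T_def)
      then have "perm_dist n \<pi> \<le> nat \<bar>int (2 * s + 1) - int (2 * s + 2)\<bar>
          + nat \<bar>int (\<pi> (2 * s + 1)) - int (\<pi> (2 * s + 2))\<bar>"
        by (intro perm_dist_le \<pi>(1)) auto
      then show ?thesis using \<pi>(2) by simp
    qed
    then show "\<pi> \<in> spread_perms d n T" using \<pi>(1) by (simp add: spread_perms_def)
  qed
  then have "card {\<pi>. \<pi> permutes {1..n} \<and> d + 2 \<le> perm_dist n \<pi>} \<le> card (spread_perms d n T)"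
    by (intro card_mono finite_subset[of "spread_perms d n T" "{\<pi>. \<pi> permutes {1..n}}"])
       (auto simp: spread_perms_def finite_permutations)
  then have "real (card {\<pi>. \<pi> permutes {1..n} \<and> d + 2 \<le> perm_dist n \<pi>}) \<le> (1 - q) ^ T * fact n"
    using spread by linarith
  then have "dist_tail n (d + 2) \<le> (1 - q) ^ T" by (simp add: dist_tail_def field_simps)
  also have "\<dots> \<le> exp (- q) ^ T"
    using q exp_ge_add_one_self[of "- q"] by (intro power_mono) auto
  also have "\<dots> = exp (- (q * real T))" by (simp add: exp_of_nat_mult[symmetric] mult.commute)
  also have "\<dots> \<le> exp (- (real d + 1) / 128)"
  proof -
    \<comment> \<open>Rounding in \<open>n div 4\<close> costs at most a factor 2 for the n at hand,
      which are at least 16; 128 is 16 times 8.\<close>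
    have "n \<le> 8 * T" using D unfolding T_def by presburger
    then have "real n \<le> 8 * real T" by linarith
    then have "q * real n \<le> q * (8 * real T)" using q by (intro mult_left_mono)
    moreover have "q * real n = (real d + 1) / 16" using D by (simp add: q_def)
    ultimately show ?thesis by simp
  qed
  finally show ?thesis .
qed

text \<open>Positions 1 and 2 already have distance at most 1 + (n - 1). This covers the range k > n
  in the uniform tail bound.\<close>

lemma dist_tail_eq_0:
  assumes n: "n \<ge> 2" and k: "k > n"
  shows "dist_tail n k = 0"
proof -
  have "perm_dist n \<pi> < k" if \<pi>: "\<pi> permutes {1..n}" for \<pi>
  proof -
    have "\<pi> 1 \<in> {1..n}" "\<pi> 2 \<in> {1..n}" using permutes_in_image[OF \<pi>] n by simp_all
    then have "nat \<bar>int 1 - int 2\<bar> + nat \<bar>int (\<pi> 1) - int (\<pi> 2)\<bar> \<le> n" by auto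
    moreover have "perm_dist n \<pi> \<le> nat \<bar>int 1 - int 2\<bar> + nat \<bar>int (\<pi> 1) - int (\<pi> 2)\<bar>"
      using n by (intro perm_dist_le[OF \<pi>]) auto
    ultimately show ?thesis using k by linarith
  qed
  then have "{\<pi>. \<pi> permutes {1..n} \<and> k \<le> perm_dist n \<pi>} = {}" by (auto simp: not_le)
  then show ?thesis by (simp only: dist_tail_def card.empty of_nat_0 div_0)
qed

text \<open>One bound for all k, uniform in n: the summand 2 makes the right side at least 1 for k
  below 17 and absorbs the shift from k - 1 to k elsewhere.\<close>

lemma dist_tail_le:
  assumes n: "n \<ge> 2"
  shows "dist_tail n k \<le> exp (2 - real k / 128)"
proof (cases "17 \<le> k")
  case False
  then have "1 \<le> exp (2 - real k / 128)" by simp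
  then show ?thesis using dist_tail_le_1[of n k] by linarith
next
  case True
  show ?thesis
  proof (cases "k > n")
    case True
    then show ?thesis using dist_tail_eq_0[OF n] by simp
  next
    case False
    define d where "d = k - 2"
    have d: "k = d + 2" using \<open>17 \<le> k\<close> by (simp add: d_def)
    have "dist_tail n k \<le> exp (- (real d + 1) / 128)"
      unfolding d using d False \<open>17 \<le> k\<close> by (intro dist_tail_exp_bound) auto
    also have "\<dots> \<le> exp (2 - real k / 128)" using d by (simp add: field_simps)
    finally show ?thesis .
  qed
qed

subsection \<open>Convergence of moments\<close>

lemma dist_tail_low:
  assumes n: "n \<ge> 2" and k: "k \<le> 2"
  shows "dist_tail n k = 1"
proof -
  \<comment> \<open>For d = 0 the sum over box shapes is empty: points differing in both coordinates
    have distance at least 2.\<close>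
  have "card (close_pairs 0 n) = 0" by (simp add: card_close_pairs)
  then have "close_pairs 0 n = {}" by simp
  then have "2 \<le> perm_dist n \<pi>" if "\<pi> permutes {1..n}" for \<pi>
    using perm_dist_ge_iff[OF n that, of 0] by simp
  then have "{\<pi>. \<pi> permutes {1..n} \<and> k \<le> perm_dist n \<pi>} = {\<pi>. \<pi> permutes {1..n}}"
    using k by (meson order_trans)
  then show ?thesis using card_permutations[of "{1..n}" n] by (simp add: dist_tail_def)
qed

text \<open>The probability that Y is at least k. The cases below 2 are separated because of
  truncated subtraction; at k = 2 the formula also gives 1.\<close>

definition Y_tail :: "nat \<Rightarrow> real" where
  "Y_tail k = (if k < 2 then 1 else exp (- (real (k - 2) ^ 2) - real (k - 2)))"

lemma Y_pmf_eq: "Y_pmf k = Y_tail k - Y_tail (Suc k)"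
proof (cases "k < 2")
  case True
  then have "k = 0 \<or> k = 1" by auto
  then show ?thesis by (auto simp: Y_pmf_def Y_tail_def)
next
  case False
  then have "Suc k - 2 = k - 1" by simp
  then show ?thesis using False by (simp add: Y_pmf_def Y_tail_def)
qed

lemma dist_tail_tendsto: "(\<lambda>n. dist_tail n k) \<longlonglongrightarrow> Y_tail k"
proof (cases "k < 2")
  case True
  have "\<forall>\<^sub>F n in sequentially. dist_tail n k = 1"
    using eventually_ge_at_top[of 2] by eventually_elim (use True in \<open>simp add: dist_tail_low\<close>)
  then show ?thesis using True by (simp add: Y_tail_def tendsto_eventually)
next
  case False
  then have "k = (k - 2) + 2" by simp
  then show ?thesis using dist_tail_limit[of "k - 2"] False by (simp add: Y_tail_def)
qed

text \<open>Grouping permutations by their distance turns the average into a series with finitely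
  many nonzero terms, the form to which Tannery's theorem applies.\<close>

lemma moment_Yn_eq_suminf:
  "moment_Yn a n = (\<Sum>k. real k ^ a * (dist_tail n k - dist_tail n (Suc k)))"
proof -
  define S where "S = {\<pi>. \<pi> permutes {1..n::nat}}"
  define Z where "Z = perm_dist n ` S"
  have fS: "finite S" unfolding S_def by (rule finite_permutations) simp
  have diff: "dist_tail n k - dist_tail n (Suc k) = real (card {\<pi> \<in> S. perm_dist n \<pi> = k}) / fact n" for k
  proof -
    have "{\<pi> \<in> S. k \<le> perm_dist n \<pi>} = {\<pi> \<in> S. Suc k \<le> perm_dist n \<pi>} \<union> {\<pi> \<in> S. perm_dist n \<pi> = k}"
      by auto
    then have "card {\<pi> \<in> S. k \<le> perm_dist n \<pi>}
        = card {\<pi> \<in> S. Suc k \<le> perm_dist n \<pi>} + card {\<pi> \<in> S. perm_dist n \<pi> = k}"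
      using fS by (simp only:) (subst card_Un_disjoint, auto)
    then show ?thesis by (simp add: dist_tail_def S_def add_divide_distrib)
  qed
  have "(\<Sum>k. real k ^ a * (dist_tail n k - dist_tail n (Suc k)))
      = (\<Sum>k\<in>Z. real k ^ a * (dist_tail n k - dist_tail n (Suc k)))"
  proof (rule suminf_finite)
    fix k assume "k \<notin> Z"
    then have "{\<pi> \<in> S. perm_dist n \<pi> = k} = {}" by (auto simp: Z_def)
    then show "real k ^ a * (dist_tail n k - dist_tail n (Suc k)) = 0"
      by (simp only: diff card.empty of_nat_0 div_0 mult_zero_right)
  qed (use fS in \<open>simp add: Z_def\<close>)
  also have "\<dots> = (\<Sum>k\<in>Z. \<Sum>\<pi> | \<pi> \<in> S \<and> perm_dist n \<pi> = k. real (perm_dist n \<pi>) ^ a) / fact n"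
    by (simp add: diff sum_divide_distrib mult.commute)
  also have "(\<Sum>k\<in>Z. \<Sum>\<pi> | \<pi> \<in> S \<and> perm_dist n \<pi> = k. real (perm_dist n \<pi>) ^ a)
      = (\<Sum>\<pi>\<in>S. real (perm_dist n \<pi>) ^ a)"
    using fS by (intro sum.group) (auto simp: Z_def)
  finally show ?thesis
    using card_permutations[of "{1..n}" n] by (simp add: moment_Yn_def S_def)
qed

text \<open>The exponential beats x^(a + 2), so the terms are eventually below a multiple of 1/k^2.
  This series is the dominating one for every moment.\<close>

lemma summable_power_times_exp:
  "summable (\<lambda>k. real k ^ a * exp (2 - real k / 128))"
proof (rule summable_comparison_test_ev)
  have "((\<lambda>x. x ^ (a + 2) / exp x) \<longlongrightarrow> (0::real)) at_top" by (rule tendsto_power_div_exp_0)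
  moreover have "filterlim (\<lambda>k. real k / 128) at_top sequentially"
    unfolding divide_inverse
    by (rule filterlim_at_top_mult_tendsto_pos[OF tendsto_const _ filterlim_real_sequentially]) simp
  ultimately have "(\<lambda>k. (real k / 128) ^ (a + 2) / exp (real k / 128)) \<longlonglongrightarrow> 0"
    by (rule filterlim_compose)
  then have "\<forall>\<^sub>F k in sequentially. (real k / 128) ^ (a + 2) / exp (real k / 128) < 1"
    by (rule order_tendstoD) simp
  then show "\<forall>\<^sub>F k in sequentially. norm (real k ^ a * exp (2 - real k / 128))
      \<le> exp 2 * 128 ^ (a + 2) * (1 / real k ^ 2)"
    using eventually_gt_at_top[of 0]
  proof eventually_elim
    case (elim k)
    then have "real k ^ (a + 2) \<le> 128 ^ (a + 2) * exp (real k / 128)"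
      by (simp add: power_divide field_simps)
    then have "real k ^ a * real k ^ 2 \<le> 128 ^ (a + 2) * exp (real k / 128)"
      by (simp only: power_add)
    then have "real k ^ a * exp (- (real k / 128)) \<le> 128 ^ (a + 2) * (1 / real k ^ 2)"
      using elim(2) by (simp add: exp_minus field_simps)
    then have "exp 2 * (real k ^ a * exp (- (real k / 128))) \<le> exp 2 * (128 ^ (a + 2) * (1 / real k ^ 2))"
      by (intro mult_left_mono) auto
    moreover have "exp (2 - real k / 128) = exp 2 * exp (- (real k / 128))"
      by (simp flip: exp_add)
    ultimately show ?case by (simp add: mult_ac abs_mult)
  qed
  show "summable (\<lambda>k. exp 2 * 128 ^ (a + 2) * (1 / real k ^ 2))"
    using inverse_power_summable[of 2, where 'a = real] by (intro summable_mult) (simp add: inverse_eq_divide)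
qed

lemma dist_tail_antimono: "dist_tail n (Suc k) \<le> dist_tail n k"
proof -
  have "card {\<pi>. \<pi> permutes {1..n} \<and> Suc k \<le> perm_dist n \<pi>} \<le> card {\<pi>. \<pi> permutes {1..n} \<and> k \<le> perm_dist n \<pi>}"
    by (intro card_mono finite_subset[OF _ finite_permutations[of "{1..n}"]]) auto
  then show ?thesis by (simp add: dist_tail_def divide_right_mono)
qed

lemma moment_Yn_tendsto: "(\<lambda>n. moment_Yn a n) \<longlonglongrightarrow> moment_Y a"
proof -
  have "(\<lambda>n. \<Sum>k. real k ^ a * (dist_tail n k - dist_tail n (Suc k)))
      \<longlonglongrightarrow> (\<Sum>k. real k ^ a * (Y_tail k - Y_tail (Suc k)))"
  proof (rule tannerys_theorem[THEN conjunct2, THEN conjunct2])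
    show "(\<lambda>n. real k ^ a * (dist_tail n k - dist_tail n (Suc k)))
        \<longlonglongrightarrow> real k ^ a * (Y_tail k - Y_tail (Suc k))" for k
      by (intro tendsto_intros dist_tail_tendsto)
    \<comment> \<open>A point probability is at most the corresponding tail, so the tail bound
      dominates the summands as soon as n is at least 2.\<close>
    have "norm (real k ^ a * (dist_tail n k - dist_tail n (Suc k))) \<le> real k ^ a * exp (2 - real k / 128)"
      if "n \<ge> 2" for n k
    proof -
      have "0 \<le> dist_tail n (Suc k)" by (simp add: dist_tail_def)
      then have "\<bar>dist_tail n k - dist_tail n (Suc k)\<bar> \<le> exp (2 - real k / 128)"
        using dist_tail_antimono[of n k] dist_tail_le[OF that, of k] by linarith
      then show ?thesis by (simp add: abs_mult mult_left_mono)
    qed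
    then show "\<forall>\<^sub>F (k, n) in sequentially \<times>\<^sub>F sequentially.
        norm (real k ^ a * (dist_tail n k - dist_tail n (Suc k))) \<le> real k ^ a * exp (2 - real k / 128)"
      unfolding case_prod_unfold
      by (intro eventually_mono[OF eventually_prodI[OF always_eventually[of "\<lambda>_. True"] eventually_ge_at_top[of 2]]]) auto
  qed (use summable_power_times_exp in auto)
  then show ?thesis by (simp add: moment_Yn_eq_suminf moment_Y_def Y_pmf_eq)
qed

lemma summable_power_times_Y_tail: "summable (\<lambda>k. real k ^ a * Y_tail k)"
proof (rule summable_comparison_test'[OF summable_power_times_exp])
  fix k :: nat
  \<comment> \<open>The bound is inherited from \<open>dist_tail_le\<close> by letting n tend to
    infinity, with no separate estimate of exp (- d^2 - d).\<close>
  have "Y_tail k \<le> exp (2 - real k / 128)"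
    by (rule LIMSEQ_le_const2[OF dist_tail_tendsto]) (use dist_tail_le in blast)
  moreover have "Y_tail k \<ge> 0" by (simp add: Y_tail_def)
  ultimately show "norm (real k ^ a * Y_tail k) \<le> real k ^ a * exp (2 - real k / 128)"
    by (simp add: abs_mult mult_left_mono)
qed

text \<open>Summation by parts: k (T(k) - T(k+1)) = (k T(k) - (k+1) T(k+1)) + T(k+1) for T =
  \<open>Y_tail\<close>. The first part telescopes to 0 because k T(k) tends to 0; in the second,
  T(1) = 1 supplies the leading 1 and the remaining terms are the stated series.\<close>

lemma moment_Y_1: "moment_Y 1 = 1 + (\<Sum>d. exp (- (real d ^ 2) - real d))"
proof -
  define g where "g d = exp (- (real d ^ 2) - real d)" for d
  have Yg: "Y_tail (Suc (Suc d)) = g d" for d by (simp add: Y_tail_def g_def)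
  have sg: "summable g"
    using summable_power_times_Y_tail[of 0] summable_Suc_iff[of "\<lambda>k. Y_tail (Suc k)"]
    by (simp add: summable_Suc_iff Yg)
  have "(\<lambda>k. Y_tail (Suc (Suc k))) sums (\<Sum>d. g d)" using sg by (simp add: Yg summable_sums)
  then have s1: "(\<lambda>k. Y_tail (Suc k)) sums ((\<Sum>d. g d) + Y_tail (Suc 0))" by (rule sums_Suc)
  have "(\<lambda>k. real k * Y_tail k) \<longlonglongrightarrow> 0"
    using summable_LIMSEQ_zero[OF summable_power_times_Y_tail[of 1]] by simp
  from telescope_sums'[OF this]
  have "(\<lambda>k. real k * Y_tail k - real (Suc k) * Y_tail (Suc k)) sums 0" by simp
  from sums_add[OF this s1]
  have "(\<lambda>k. real k ^ 1 * Y_pmf k) sums (1 + (\<Sum>d. g d))"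
    by (simp add: Y_pmf_eq algebra_simps Y_tail_def[of "Suc 0"])
  then show ?thesis unfolding moment_Y_def g_def by (rule sums_unique[symmetric])
qed

theorem theorem3:
  fixes a :: nat
  shows "((\<lambda>n. moment_Yn a n) \<longlonglongrightarrow> moment_Y a) \<and>
         ((\<lambda>n. moment_Yn 1 n) \<longlonglongrightarrow> 1 + (\<Sum>d. exp (- ((real d)^2) - real d)))"
  using moment_Yn_tendsto[of a] moment_Yn_tendsto[of 1] by (simp only: moment_Y_1)

end
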